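(* Let $K_0$ be an infinite field, $K \supseteq K_0$ a field, and $L$ a division algebra over $K_0$. A $1$-inflator from $\operatorname{Dir}_K(K)$ to $\operatorname{Dir}_L(L)$ is equivalent to the following data: - A valuation ring $\mathcal{O}$ on $K$, with trivial valuation on $K_0$. - An embedding (over $K_0$) of the residue field of $\mathcal{O}$ into $L$.
   Context: Fix an infinite field $K_0$. For an object $A$ of a $K_0$-linear abelian category $\mathcal{C}$, $\operatorname{Sub}_{\mathcal{C}}(A^n)$ is the modular lattice of subobjects of $A^n$. The directory $\operatorname{Dir}_{\mathcal{C}}(A)$ is the multi-sorted structure $(\operatorname{Sub}_{\mathcal{C}}(A^n))_{n\ge1}$ with the lattice structure on each sort, the maps $\oplus: \operatorname{Sub}(A^n)\times\operatorname{Sub}(A^m)\to\operatorname{Sub}(A^{n+m})$, and the action of $GL_n(K_0)$ on $\operatorname{Sub}(A^n)$. A directory is any structure isomorphic to one of this form. If $\mathcal{C}$ is the category of left modules over a $K_0$-algebra $S$, one writes $\operatorname{Sub}_S$, $\operatorname{Dir}_S$. A morphism of directories $f:D_\bullet\to D'_\bullet$ is a family of maps $f_n:D_n\to D'_n$, each order-preserving and $GL_n(K_0)$-equivariant, with $f_{n+m}(x\oplus y)=f_n(x)\oplus f_m(y)$ (the lattice operations need not be preserved). "Semisimple" means semisimple of finite length. A directory $\operatorname{Dir}_{\mathcal{C}}(B)$ is semisimple of length $d$ if $B$ is semisimple of length $d$. For a field $K\supseteq K_0$, a $d$-inflator on $K$ is a morphism of directories $\varsigma:\operatorname{Dir}_K(K)\to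 D_\bullet$, where $D_\bullet$ is semisimple of length $d$, such that $\ell(\varsigma_n(V))=d\cdot\dim_K(V)$ for all $n$ and all $V\in\operatorname{Sub}_K(K^n)$; here $\ell$ denotes length. The trivial valuation ring $\mathcal{O}=K$ is allowed; "trivial valuation on $K_0$" means $K_0\subseteq\mathcal{O}$. For orientation: the $1$-inflator built from such data, with $\mathfrak{m}$ the maximal ideal of $\mathcal{O}$, sends $V\subseteq K^n$ to $L\otimes_{\mathcal{O}/\mathfrak{m}}\big((V\cap\mathcal{O}^n+\mathfrak{m}^n)/\mathfrak{m}^n\big)\subseteq L^n$. *)

theory Defs
  imports
    "Jordan_Normal_Form.VS_Connect"
    "HOL-Algebra.Subrings"
    "HOL-Algebra.QuotRing"
    "HOL-Library.FuncSet"
    "HOL-Library.Extended_Nat"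
begin

section \<open>Directories of modules\<close>

text \<open>
  Algebras over the field \<open>K\<^sub>0 = 'k0\<close> are given by a structure map into the centre.
  For a field \<open>'s\<close> the centrality condition is automatic, and the structure map is an
  embedding \<open>K\<^sub>0 \<subseteq> 's\<close>.
\<close>

locale K0_algebra = Ring_Hom.ring_hom e for e :: "'k0::field \<Rightarrow> 's::ring_1" +
  assumes central: "e c * x = x * e c"

text \<open>
  A left module over \<open>'s\<close> is the type \<open>'b\<close> with the left scalar multiplication \<open>sc\<close>; its
  power \<open>B\<^sup>n\<close> is \<^term>\<open>carrier_vec n\<close>. The regular module is obtained with \<open>sc = (*)\<close>.
\<close>

definition Sub :: "('s::ring_1 \<Rightarrow> 'b::ab_group_add \<Rightarrow> 'b) \<Rightarrow> nat \<Rightarrow> 'b vec set set" where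
  "Sub sc n = {V. V \<subseteq> carrier_vec n \<and> 0\<^sub>v n \<in> V \<and>
     (\<forall>v\<in>V. \<forall>w\<in>V. v + w \<in> V) \<and> (\<forall>a. \<forall>v\<in>V. map_vec (sc a) v \<in> V)}"

definition GL :: "nat \<Rightarrow> 'k0::field mat set" where
  "GL n = {A \<in> carrier_mat n n. invertible_mat A}"

text \<open>
  The lattice structure of a sort is recorded by its order, which determines meets and joins.
  Sorts are indexed by \<open>n \<ge> 1\<close>; the value of \<open>Sort\<close> at \<open>0\<close> is irrelevant.
\<close>

record ('k0, 'x) directory =
  Sort :: "nat \<Rightarrow> 'x set"
  Le :: "'x \<Rightarrow> 'x \<Rightarrow> bool"
  Oplus :: "'x \<Rightarrow> 'x \<Rightarrow> 'x"
  Act :: "nat \<Rightarrow> 'k0 mat \<Rightarrow> 'x \<Rightarrow> 'x"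

definition Dir ::
  "('k0::field \<Rightarrow> 's::ring_1) \<Rightarrow> ('s \<Rightarrow> 'b::ab_group_add \<Rightarrow> 'b) \<Rightarrow> ('k0, 'b vec set) directory"
  where
  "Dir e sc = \<lparr>
     Sort = Sub sc,
     Le = (\<subseteq>),
     Oplus = (\<lambda>V W. {v @\<^sub>v w | v w. v \<in> V \<and> w \<in> W}),
     Act = (\<lambda>n A V. (\<lambda>v. vec n (\<lambda>i. \<Sum>j<n. sc (e (A $$ (i, j))) (v $ j))) ` V) \<rparr>"

text \<open>
  Families of maps are taken extensional (\<open>undefined\<close> outside the sorts and at \<open>n = 0\<close>), so
  that equality of families is equality of HOL functions.
\<close>

definition directory_morphism ::
  "('k0::field, 'x) directory \<Rightarrow> ('k0, 'y) directory \<Rightarrow> (nat \<Rightarrow> 'x \<Rightarrow> 'y) \<Rightarrow> bool" where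
  "directory_morphism D D' f \<longleftrightarrow>
     f \<in> (\<Pi>\<^sub>E n\<in>{1..}. Sort D n \<rightarrow>\<^sub>E Sort D' n) \<and>
     (\<forall>n\<ge>1. \<forall>x\<in>Sort D n. \<forall>y\<in>Sort D n. Le D x y \<longrightarrow> Le D' (f n x) (f n y)) \<and>
     (\<forall>n\<ge>1. \<forall>A\<in>GL n. \<forall>x\<in>Sort D n. f n (Act D n A x) = Act D' n A (f n x)) \<and>
     (\<forall>n\<ge>1. \<forall>m\<ge>1. \<forall>x\<in>Sort D n. \<forall>y\<in>Sort D m.
        f (n + m) (Oplus D x y) = Oplus D' (f n x) (f m y))"

section \<open>Inflators\<close>

definition module_length ::
  "('s::ring_1 \<Rightarrow> 'b::ab_group_add \<Rightarrow> 'b) \<Rightarrow> nat \<Rightarrow> 'b vec set \<Rightarrow> enat" where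
  "module_length sc n V =
     Sup {enat k | k C. subset.chain {W \<in> Sub sc n. W \<subseteq> V} C \<and> finite C \<and> card C = Suc k}"

text \<open>\<open>B\<close> is identified with \<open>B\<^sup>1\<close>. Semisimple: every submodule is a direct summand.\<close>

definition semisimple_of_length ::
  "('s::ring_1 \<Rightarrow> 'b::ab_group_add \<Rightarrow> 'b) \<Rightarrow> nat \<Rightarrow> bool" where
  "semisimple_of_length sc d \<longleftrightarrow>
     (\<forall>U\<in>Sub sc 1. \<exists>W\<in>Sub sc 1.
        U \<inter> W = {0\<^sub>v 1} \<and> {u + w | u w. u \<in> U \<and> w \<in> W} = carrier_vec 1) \<and>
     module_length sc 1 (carrier_vec 1) = enat d"

definition vdim :: "nat \<Rightarrow> 'k::field vec set \<Rightarrow> nat" where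
  "vdim n V = vectorspace.dim class_ring (module_vec TYPE('k) n \<lparr>carrier := V\<rparr>)"

definition inflator ::
  "nat \<Rightarrow> ('k0::field \<Rightarrow> 'k::field) \<Rightarrow> ('k0 \<Rightarrow> 's::ring_1) \<Rightarrow> ('s \<Rightarrow> 'b::ab_group_add \<Rightarrow> 'b)
     \<Rightarrow> (nat \<Rightarrow> 'k vec set \<Rightarrow> 'b vec set) \<Rightarrow> bool" where
  "inflator d eK eS sc f \<longleftrightarrow>
     semisimple_of_length sc d \<and>
     directory_morphism (Dir eK (*)) (Dir eS sc) f \<and>
     (\<forall>n\<ge>1. \<forall>V\<in>Sub (*) n. module_length sc n (f n V) = enat (d * vdim n V))"

section \<open>Valuation rings and the inflator attached to an embedded residue field\<close>

definition valuation_ring :: "'k::field set \<Rightarrow> bool" where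
  "valuation_ring R \<longleftrightarrow> subring R class_ring \<and> (\<forall>x. x \<in> R \<or> inverse x \<in> R)"

text \<open>The maximal ideal is the set of non-units; recall \<open>inverse 0 = 0\<close>.\<close>

definition max_ideal :: "'k::field set \<Rightarrow> 'k set" where
  "max_ideal R = {x \<in> R. x = 0 \<or> inverse x \<notin> R}"

definition residue_field :: "'k::field set \<Rightarrow> 'k set ring" where
  "residue_field R = class_ring\<lparr>carrier := R\<rparr> Quot max_ideal R"

definition residue :: "'k::field set \<Rightarrow> 'k \<Rightarrow> 'k set" where
  "residue R x = max_ideal R +>\<^bsub>class_ring\<lparr>carrier := R\<rparr>\<^esub> x"

definition valuation_data ::
  "('k0::field \<Rightarrow> 'k::field) \<Rightarrow> ('k0 \<Rightarrow> 'l::division_ring) \<Rightarrow> ('k set \<times> ('k set \<Rightarrow> 'l)) set" where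
  "valuation_data eK eL = {(R, \<phi>).
     valuation_ring R \<and> range eK \<subseteq> R \<and>
     \<phi> \<in> Ring.ring_hom (residue_field R) class_ring \<and>
     inj_on \<phi> (carrier (residue_field R)) \<and>
     (\<forall>c. \<phi> (residue R (eK c)) = eL c) \<and>
     \<phi> \<in> extensional (carrier (residue_field R))}"

text \<open>\<open>(V \<inter> R\<^sup>n + \<mm>\<^sup>n) / \<mm>\<^sup>n\<close>, as a set of vectors over the residue field.\<close>

definition reduction :: "'k::field set \<Rightarrow> 'k vec set \<Rightarrow> 'k set vec set" where
  "reduction R V = map_vec (residue R) ` {v \<in> V. \<forall>i<dim_vec v. v $ i \<in> R}"

text \<open>
  For a subspace \<open>W\<close> of \<open>(R/\<mm>)\<^sup>n\<close>, the tensor product of \<open>L\<close> with \<open>W\<close>, as a submodule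
  of \<open>L\<^sup>n\<close>, is the left \<open>L\<close>-span of the image of \<open>W\<close> in \<open>L\<^sup>n\<close>.
\<close>

definition data_inflator ::
  "'k::field set \<Rightarrow> ('k set \<Rightarrow> 'l::division_ring) \<Rightarrow> nat \<Rightarrow> 'k vec set \<Rightarrow> 'l vec set" where
  "data_inflator R \<phi> = (\<lambda>n\<in>{1..}. \<lambda>V\<in>Sub (*) n.
     (\<lambda>M. M \<in> Sub (*) n) hull (map_vec \<phi> ` reduction R V))"

end

theory Submission
  imports Defs
begin

text \<open>
  A valuation ring with an embedded residue field amounts to a place \<open>s\<close> of \<open>K\<close>. Its
  specialization map preserves lengths because every \<open>V \<subseteq> K\<^sup>n\<close> has a reduced echelon basis
  with entries in the valuation ring, and \<open>s\<close> maps it to a reduced echelon basis.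

  Conversely, a \<open>1\<close>-inflator \<open>f\<close> sends the line of \<open>(1, a)\<close> to a line of \<open>L\<^sup>2\<close>, which is either
  the line of some \<open>(1, b)\<close> or that of \<open>(0, 1)\<close>. Put \<open>s a = b\<close> or \<open>s a = \<infinity>\<close> accordingly. Compatibility of
  \<open>f\<close> with rectangular matrices over \<open>K\<^sub>0\<close>, applied to the lines of \<open>(1, a, b)\<close> and \<open>(1, a, ab)\<close>,
  shows that \<open>s\<close> is a place. The specialization of \<open>V\<close> along \<open>s\<close> is then contained in \<open>f V\<close>,
  and both have length \<open>dim V\<close>.
\<close>

section \<open>Submodules and their lengths\<close>

text \<open>A morphism of directories need not preserve joins, so \<open>f V\<close> cannot be
  assembled from the images of the lines in \<open>V\<close>. Monotonicity still puts those images
  inside \<open>f V\<close>, and the prescribed lengths turn such an inclusion into an equality.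
  Since \<open>L\<close> may be noncommutative, lengths are counted through pivot coordinates; one
  set of pivots serves both a subspace over \<open>K\<close> and its specialization over
  \<open>L\<close>. Scalars act from the left throughout, so the image of the line of
  \<open>(1, a)\<close> has the equation \<open>y = x * s a\<close>. This fixes the order of factors
  and lets an unknown left multiple cancel. Only matrices over the base field act on a directory, so
  multiplication in \<open>K\<close> has to enter through collinearity: \<open>(a, ab)\<close> lies
  on the line of \<open>(1, b)\<close>, and hence a vector in the image of the line of
  \<open>(1, a, ab)\<close> is a left multiple of \<open>(1, s a, s a * s b)\<close>.\<close>

lemma map_vec_times: "map_vec ((*) a) v = a \<cdot>\<^sub>v v"
  by (rule eq_vecI) auto

lemma Sub_iff:
  "V \<in> Sub (*) n \<longleftrightarrow> V \<subseteq> carrier_vec n \<and> 0\<^sub>v n \<in> V \<and>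
     (\<forall>v\<in>V. \<forall>w\<in>V. v + w \<in> V) \<and> (\<forall>a. \<forall>v\<in>V. a \<cdot>\<^sub>v v \<in> V)"
  by (simp add: Sub_def map_vec_times)

lemma Sub_carrier: "V \<in> Sub (*) n \<Longrightarrow> v \<in> V \<Longrightarrow> v \<in> carrier_vec n"
  and Sub_dim: "V \<in> Sub (*) n \<Longrightarrow> v \<in> V \<Longrightarrow> dim_vec v = n"
  and Sub_zero: "V \<in> Sub (*) n \<Longrightarrow> 0\<^sub>v n \<in> V"
  and Sub_add: "V \<in> Sub (*) n \<Longrightarrow> v \<in> V \<Longrightarrow> w \<in> V \<Longrightarrow> v + w \<in> V"
  and Sub_smult: "V \<in> Sub (*) n \<Longrightarrow> v \<in> V \<Longrightarrow> a \<cdot>\<^sub>v v \<in> V"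
  by (auto simp: Sub_iff)

lemma SubI:
  assumes "\<And>v. v \<in> V \<Longrightarrow> v \<in> carrier_vec n" "0\<^sub>v n \<in> V"
    and "\<And>v w. v \<in> V \<Longrightarrow> w \<in> V \<Longrightarrow> v + w \<in> V" "\<And>a v. v \<in> V \<Longrightarrow> a \<cdot>\<^sub>v v \<in> V"
  shows "V \<in> Sub (*) n"
  using assms by (auto simp: Sub_iff)

lemma Sub_diff:
  assumes V: "V \<in> Sub (*) n" and v: "v \<in> V" and w: "w \<in> V"
  shows "v + (- a) \<cdot>\<^sub>v w \<in> V"
  using assms by (simp add: Sub_add Sub_smult)

lemma zero_in_Sub: "{0\<^sub>v n} \<in> Sub (*) n"
  by (rule SubI) auto

lemma carrier_in_Sub: "carrier_vec n \<in> Sub (*) n"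
  by (rule SubI) auto

text \<open>
  Lengths over a division ring are counted by leading indices: within a submodule whose vectors
  are determined by their coordinates in \<open>P\<close>, a proper inclusion enlarges the set of leading
  indices, so chains have at most \<open>card P\<close> proper steps.
\<close>

definition separates :: "nat set \<Rightarrow> 'a::zero vec set \<Rightarrow> nat \<Rightarrow> bool" where
  "separates P M n \<longleftrightarrow> (\<forall>w\<in>M. (\<forall>p\<in>P. w $ p = 0) \<longrightarrow> w = 0\<^sub>v n)"

definition leading :: "nat set \<Rightarrow> 'a::zero vec set \<Rightarrow> nat set" where
  "leading P M = {i\<in>P. \<exists>w\<in>M. w $ i \<noteq> 0 \<and> (\<forall>j\<in>P. j < i \<longrightarrow> w $ j = 0)}"

lemma Sub_eq_by_leading:
  fixes M N :: "'l::division_ring vec set"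
  assumes M: "M \<in> Sub (*) n" and N: "N \<in> Sub (*) n" and MN: "M \<subseteq> N"
    and P: "P \<subseteq> {..<n}" and sep: "separates P N n"
    and lead: "leading P N \<subseteq> leading P M"
  shows "M = N"
proof -
  \<comment> \<open>The induction runs downwards from \<open>k = n\<close>, where
    \<open>separates\<close> forces \<open>w\<close> to be zero; a vector of \<open>M\<close>
    leading at \<open>k\<close> clears one more coordinate.\<close>
  have "w \<in> M" if "w \<in> N" "\<forall>p\<in>P. p < k \<longrightarrow> w $ p = 0" "k \<le> n" for k w
    using that(3,1,2)
  proof (induction k arbitrary: w rule: inc_induct)
    case base
    have "\<forall>p\<in>P. w $ p = 0" using base P by auto
    then have "w = 0\<^sub>v n" using base sep by (simp add: separates_def)
    then show ?case using Sub_zero[OF M] by simp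
  next
    case (step k)
    show ?case
    proof (cases "k \<in> P \<and> w $ k \<noteq> 0")
      case False
      then show ?thesis using step by (metis less_Suc_eq)
    next
      case True
      then have "k \<in> leading P M" using step lead by (auto simp: leading_def)
      then obtain m where m: "m \<in> M" "m $ k \<noteq> 0" "\<forall>j\<in>P. j < k \<longrightarrow> m $ j = 0"
        by (auto simp: leading_def)
      \<comment> \<open>Scalars act from the left, so the inverse stands on the right in order that
        \<open>c * m $ k = w $ k\<close>.\<close>
      define c where "c = w $ k * inverse (m $ k)"
      define w' where "w' = w + (- c) \<cdot>\<^sub>v m"
      have dims: "dim_vec w = n" "dim_vec m = n" using step m MN Sub_dim[OF N] by auto
      have "w' \<in> N" unfolding w'_def using step m MN by (intro Sub_diff[OF N]) auto
      moreover have "\<forall>p\<in>P. p < Suc k \<longrightarrow> w' $ p = 0"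
        using step m P dims by (auto simp: w'_def less_Suc_eq c_def mult.assoc)
      ultimately have "w' \<in> M" using step.IH by blast
      then have "w' + c \<cdot>\<^sub>v m \<in> M" using M m by (simp add: Sub_add Sub_smult)
      moreover have "w' + c \<cdot>\<^sub>v m = w" using dims by (intro eq_vecI) (auto simp: w'_def)
      ultimately show ?thesis by simp
    qed
  qed
  from this[of _ 0] MN show ?thesis by auto
qed

lemma chain_le_module_length:
  assumes "subset.chain {W \<in> Sub sc n. W \<subseteq> V} C" "finite C" "card C = Suc k"
  shows "enat k \<le> module_length sc n V"
  unfolding module_length_def using assms by (intro Sup_upper) auto

lemma module_length_le:
  fixes M :: "'l::division_ring vec set"
  assumes M: "M \<in> Sub (*) n" and P: "P \<subseteq> {..<n}" and sep: "separates P M n"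
  shows "module_length (*) n M \<le> enat (card P)"
  unfolding module_length_def
proof (rule Sup_least, clarify)
  fix k C
  assume C: "subset.chain {W \<in> Sub (*) n. W \<subseteq> M} C" "finite C" "card C = Suc k"
  have fin: "finite P" using P finite_subset by blast
  then have finl: "finite (leading P W)" for W :: "'l vec set"
    by (simp add: leading_def)
  have strict: "W = W'" if "W \<in> C" "W' \<in> C" "W \<subseteq> W'"
      "card (leading P W) = card (leading P W')" for W W'
  proof -
    have "leading P W \<subseteq> leading P W'" using that by (auto simp: leading_def)
    then have "leading P W = leading P W'" using that finl card_subset_eq by blast
    moreover have "separates P W' n" "W \<in> Sub (*) n" "W' \<in> Sub (*) n"
      using sep that C by (auto simp: separates_def subset.chain_def)
    ultimately show ?thesis using Sub_eq_by_leading[of W n W' P] that P by auto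
  qed
  have inj: "inj_on (\<lambda>W. card (leading P W)) C"
  proof (rule inj_onI)
    fix W W' assume *: "W \<in> C" "W' \<in> C" "card (leading P W) = card (leading P W')"
    then have "W \<subseteq> W' \<or> W' \<subseteq> W" using C unfolding subset.chain_def by blast
    then show "W = W'" using * strict[of W W'] strict[of W' W] by auto
  qed
  have "card (leading P W) \<le> card P" for W :: "'l vec set"
    by (rule card_mono[OF fin]) (auto simp: leading_def)
  \<comment> \<open>The target has \<open>Suc (card P)\<close> elements, matching the
    \<open>Suc k\<close> members of a chain of length \<open>k\<close>.\<close>
  then have "(\<lambda>W. card (leading P W)) ` C \<subseteq> {..card P}" by auto
  then have "card C \<le> card {..card P}" using inj card_inj_on_le by blast
  then show "enat k \<le> enat (card P)" using C by simp
qed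

text \<open>A reduced echelon family with pivot set \<open>P\<close>: its coordinates in
  \<open>P\<close> form an identity matrix. Together with \<open>separates P M n\<close> it is a
  basis of a submodule \<open>M\<close>, since subtracting the combination with coefficients
  \<open>w $ p\<close> from \<open>w\<close> leaves a vector vanishing on \<open>P\<close>.\<close>

definition dual_family :: "nat set \<Rightarrow> 'a::zero_neq_one vec set \<Rightarrow> (nat \<Rightarrow> 'a vec) \<Rightarrow> bool" where
  "dual_family P M b \<longleftrightarrow> (\<forall>p\<in>P. b p \<in> M \<and> (\<forall>q\<in>P. b p $ q = (if p = q then 1 else 0)))"

text \<open>Vanishing on the pivots below \<open>i\<close> cuts out a descending flag, and
  \<open>b p\<close> belongs to \<open>F p\<close> but to no later member. No \<open>F p\<close>
  with \<open>p \<in> P\<close> is zero, so the zero submodule supplies the one extra member that a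
  chain of length \<open>card P\<close> needs.\<close>

lemma module_length_ge:
  fixes M :: "'l::ring_1 vec set"
  assumes M: "M \<in> Sub (*) n" and P: "P \<subseteq> {..<n}" and b: "dual_family P M b"
  shows "enat (card P) \<le> module_length (*) n M"
proof -
  define F where "F i = {w\<in>M. \<forall>j\<in>P. j < i \<longrightarrow> w $ j = 0}" for i
  have F: "F i \<in> Sub (*) n" for i
  proof (rule SubI)
    show "v \<in> carrier_vec n" if "v \<in> F i" for v
      using that Sub_carrier[OF M] by (auto simp: F_def)
    show "0\<^sub>v n \<in> F i" using P Sub_zero[OF M] by (auto simp: F_def)
    show "v + w \<in> F i" if "v \<in> F i" "w \<in> F i" for v w
      using that Sub_add[OF M] Sub_dim[OF M, of v] Sub_dim[OF M, of w] P by (auto simp: F_def)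
    show "a \<cdot>\<^sub>v v \<in> F i" if "v \<in> F i" for a v
      using that Sub_smult[OF M] Sub_dim[OF M, of v] P by (auto simp: F_def)
  qed
  have bF: "b p \<in> F p" if "p \<in> P" for p using b that by (auto simp: F_def dual_family_def)
  have bn: "b p \<notin> F i" if "p \<in> P" "p < i" for p i using b that by (auto simp: F_def dual_family_def)
  have inj: "inj_on F P"
    by (rule inj_onI) (metis bF bn linorder_neqE_nat)
  have nz: "{0\<^sub>v n} \<notin> F ` P"
  proof
    assume "{0\<^sub>v n} \<in> F ` P"
    then obtain p where p: "p \<in> P" "F p = {0\<^sub>v n}" by auto
    then have "b p = 0\<^sub>v n" using bF by blast
    moreover have "b p $ p = 1" using b p by (auto simp: dual_family_def)
    ultimately show False using p P by auto
  qed
  have fin: "finite P" using P finite_subset by blast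
  have anti: "F j \<subseteq> F i" if "i \<le> j" for i j using that by (auto simp: F_def)
  show ?thesis
  proof (rule chain_le_module_length)
    show "subset.chain {W \<in> Sub (*) n. W \<subseteq> M} (insert {0\<^sub>v n} (F ` P))"
    proof (rule subset.chainI)
      show "insert {0\<^sub>v n} (F ` P) \<subseteq> {W \<in> Sub (*) n. W \<subseteq> M}"
        using F zero_in_Sub Sub_zero[OF M] by (auto simp: F_def)
      show "(\<subset>)\<^sup>=\<^sup>= W W' \<or> (\<subset>)\<^sup>=\<^sup>= W' W"
        if "W \<in> insert {0\<^sub>v n} (F ` P)" "W' \<in> insert {0\<^sub>v n} (F ` P)" for W W'
        using that anti Sub_zero[OF F] nat_le_linear by auto blast+
    qed
    show "finite (insert {0\<^sub>v n} (F ` P))" using fin by simp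
    show "card (insert {0\<^sub>v n} (F ` P)) = Suc (card P)"
      using fin nz inj by (simp add: card_image)
  qed
qed

lemma module_length_eq:
  fixes M :: "'l::division_ring vec set"
  assumes "M \<in> Sub (*) n" "P \<subseteq> {..<n}" "separates P M n" "dual_family P M b"
  shows "module_length (*) n M = enat (card P)"
  using module_length_le module_length_ge assms by (metis antisym)

lemma module_length_strict:
  fixes V W :: "'l::ring_1 vec set"
  assumes V: "V \<in> Sub (*) n" and W: "W \<in> Sub (*) n" and VW: "V \<subset> W"
    and len: "module_length (*) n V = enat d"
  shows "enat (Suc d) \<le> module_length (*) n W"
proof -
  define S where "S = {enat k | k C. subset.chain {U \<in> Sub (*) n. U \<subseteq> V} C \<and> finite C \<and> card C = Suc k}"
  have "subset.chain {U \<in> Sub (*) n. U \<subseteq> V} {{0\<^sub>v n}}"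
    using zero_in_Sub Sub_zero[OF V] by (auto simp: subset.chain_def)
  \<comment> \<open>A finite supremum of a nonempty set of \<open>enat\<close> is attained. The
    empty set also has supremum 0, so nonemptiness must be secured before a longest chain can be
    chosen.\<close>
  then have "enat 0 \<in> S" unfolding S_def
    by (intro CollectI exI[of _ 0] exI[of _ "{{0\<^sub>v n}}"]) auto
  moreover have "Sup S = enat d" using len by (simp add: S_def module_length_def)
  ultimately have "enat d \<in> S"
    by (metis (no_types, lifting) Sup_enat_def Max_in empty_iff enat.distinct(1))
  then obtain C where C: "subset.chain {U \<in> Sub (*) n. U \<subseteq> V} C" "finite C" "card C = Suc d"
    by (auto simp: S_def)
  have le: "U \<in> Sub (*) n" "U \<subset> W" if "U \<in> C" for U
    using that C VW by (auto simp: subset.chain_def)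
  show ?thesis
  proof (rule chain_le_module_length)
    show "subset.chain {U \<in> Sub (*) n. U \<subseteq> W} (insert W C)"
      using C W le unfolding subset.chain_def by auto
    show "finite (insert W C)" using C by simp
    show "card (insert W C) = Suc (Suc d)" using C le by (subst card_insert_disjoint) auto
  qed
qed

text \<open>The tool that upgrades every one-sided inclusion: a longest chain in a proper submodule
  could be extended by the larger module.\<close>

lemma Sub_eq_by_length:
  fixes V W :: "'l::ring_1 vec set"
  assumes "V \<in> Sub (*) n" "W \<in> Sub (*) n" "V \<subseteq> W"
    and "module_length (*) n V = enat d" "module_length (*) n W = enat d"
  shows "V = W"
  using module_length_strict[of V n W d] assms by fastforce

section \<open>Lines and submodules of length one\<close>

definition line :: "'a::ring_1 vec \<Rightarrow> 'a vec set" where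
  "line v = range (\<lambda>x. x \<cdot>\<^sub>v v)"

lemma line_in_Sub: "v \<in> carrier_vec n \<Longrightarrow> line v \<in> Sub (*) n"
proof (rule SubI)
  assume v: "v \<in> carrier_vec n"
  show "w \<in> carrier_vec n" if "w \<in> line v" for w using v that by (auto simp: line_def)
  show "0\<^sub>v n \<in> line v" using v by (auto simp: line_def intro!: image_eqI[of _ _ 0])
  show "u + w \<in> line v" if "u \<in> line v" "w \<in> line v" for u w
    using that by (auto simp: line_def add_smult_distrib_vec[symmetric])
  show "a \<cdot>\<^sub>v w \<in> line v" if "w \<in> line v" for a w
    using that by (auto simp: line_def smult_smult_assoc)
qed

lemma line_self: "v \<in> line v"
  by (auto simp: line_def intro!: image_eqI[of _ _ 1])

lemma line_separated:
  fixes v :: "'l::division_ring vec"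
  assumes v: "v \<in> carrier_vec n" and i: "i < n" "v $ i \<noteq> 0"
  shows "separates {i} (line v) n"
    and "dual_family {i} (line v) (\<lambda>_. inverse (v $ i) \<cdot>\<^sub>v v)"
  using assms by (auto simp: separates_def dual_family_def line_def)

lemma nonzero_coordinate:
  assumes "v \<in> carrier_vec n" "v \<noteq> 0\<^sub>v n"
  obtains i where "i < n" "v $ i \<noteq> 0"
  using assms by (metis eq_vecI carrier_vecD index_zero_vec)

lemma module_length_line:
  fixes v :: "'l::division_ring vec"
  assumes v: "v \<in> carrier_vec n" "v \<noteq> 0\<^sub>v n"
  shows "module_length (*) n (line v) = enat 1"
proof -
  obtain i where i: "i < n" "v $ i \<noteq> 0" using nonzero_coordinate v .
  show ?thesis
    using module_length_eq[OF line_in_Sub[OF v(1)] _ line_separated[OF v(1) i]] i by simp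
qed

lemma length_one_imp_line:
  fixes V :: "'l::division_ring vec set"
  assumes V: "V \<in> Sub (*) n" and len: "module_length (*) n V = enat 1"
    and w: "w \<in> V" "w \<noteq> 0\<^sub>v n"
  shows "V = line w"
proof -
  have wc: "w \<in> carrier_vec n" using V w Sub_carrier by blast
  have "line w \<subseteq> V" using V w by (auto simp: line_def Sub_smult)
  then show ?thesis
    using Sub_eq_by_length[OF line_in_Sub[OF wc] V _ module_length_line[OF wc w(2)] len] by simp
qed

lemma length_zero_iff:
  fixes V :: "'l::division_ring vec set"
  assumes V: "V \<in> Sub (*) n"
  shows "module_length (*) n V = enat 0 \<longleftrightarrow> V = {0\<^sub>v n}"
proof -
  have 0: "module_length (*) n {0\<^sub>v n :: 'l vec} = enat 0"
    using module_length_eq[OF zero_in_Sub[of n], of "{}" "\<lambda>_. 0\<^sub>v n"]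
    by (simp add: separates_def dual_family_def)
  show ?thesis using Sub_eq_by_length[OF zero_in_Sub V _ 0] 0 Sub_zero[OF V] by auto
qed

text \<open>The regular module is itself a line, so length one forces every nonzero submodule to be
  everything, and the complements are the two trivial submodules.\<close>

lemma semisimple_division_ring: "semisimple_of_length ((*) :: 'l::division_ring \<Rightarrow> 'l \<Rightarrow> 'l) 1"
proof -
  define e :: "'l vec" where "e = vec 1 (\<lambda>_. 1)"
  have e: "e \<in> carrier_vec 1" "e \<noteq> 0\<^sub>v 1" by (auto simp: e_def vec_eq_iff)
  have "carrier_vec 1 = line e"
  proof
    show "carrier_vec 1 \<subseteq> line e"
    proof
      fix v :: "'l vec" assume "v \<in> carrier_vec 1"
      then have "v = v $ 0 \<cdot>\<^sub>v e" by (intro eq_vecI) (auto simp: e_def)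
      then show "v \<in> line e" by (auto simp: line_def)
    qed
  qed (use e in \<open>auto simp: line_def\<close>)
  then have len: "module_length (*) 1 (carrier_vec 1 :: 'l vec set) = enat 1"
    using module_length_line[OF e] by simp
  have dich: "U = {0\<^sub>v 1} \<or> U = carrier_vec 1" if U: "U \<in> Sub (*) 1" for U :: "'l vec set"
  proof (cases "U = {0\<^sub>v 1}")
    case False
    then obtain w where w: "w \<in> U" "w \<noteq> 0\<^sub>v 1" using Sub_zero[OF U] by auto
    have "line w \<subseteq> U" using U w by (auto simp: line_def Sub_smult)
    moreover have "carrier_vec 1 = line w"
      using length_one_imp_line[OF carrier_in_Sub len _ w(2)] w U Sub_carrier by blast
    ultimately show ?thesis using U Sub_carrier by blast
  qed simp
  have "\<exists>W\<in>Sub (*) 1. U \<inter> W = {0\<^sub>v 1} \<and> {u + w | u w. u \<in> U \<and> w \<in> W} = carrier_vec 1"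
    if "U \<in> Sub (*) 1" for U :: "'l vec set"
    using dich[OF that]
  proof
    assume "U = {0\<^sub>v 1}"
    then show ?thesis by (intro bexI[OF _ carrier_in_Sub]) (auto, metis left_zero_vec)
  next
    assume "U = carrier_vec 1"
    then show ?thesis by (intro bexI[OF _ zero_in_Sub]) force
  qed
  then show ?thesis using len by (simp add: semisimple_of_length_def)
qed

text \<open>The data \<open>P\<close>, \<open>b\<close> that compute lengths over a division ring
  compute the library dimension over a field. Dimensions over \<open>K\<close> and lengths over
  \<open>L\<close> are compared through this common index set.\<close>

lemma vdim_eq:
  fixes V :: "'k::field vec set"
  assumes V: "V \<in> Sub (*) n" and P: "P \<subseteq> {..<n}" and sep: "separates P V n"
    and b: "dual_family P V b"
  shows "vdim n V = card P"
proof -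
  interpret vec_space "TYPE('k)" n .
  have finP: "finite P" using P finite_subset by blast
  have bV: "b ` P \<subseteq> V" using b by (auto simp: dual_family_def)
  then have bc: "b ` P \<subseteq> carrier_vec n" using V by (auto simp: Sub_iff)
  have bpq: "b p $ q = (if p = q then 1 else 0)" if "p \<in> P" "q \<in> P" for p q
    using b that by (auto simp: dual_family_def)
  have inj: "inj_on b P"
    by (rule inj_onI) (metis bpq zero_neq_one)
  have index: "lincomb a (b ` P) $ q = a (b q)" if "q \<in> P" for a q
  proof -
    have "lincomb a (b ` P) $ q = (\<Sum>p\<in>P. a (b p) * b p $ q)"
      using that P bc by (subst lincomb_index) (auto simp: sum.reindex[OF inj])
    also have "\<dots> = (\<Sum>p\<in>P. if p = q then a (b p) else 0)"
      using that by (intro sum.cong) (auto simp: bpq)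
    finally show ?thesis using that finP by simp
  qed
  have submod: "submodule class_ring V (module_vec TYPE('k) n)"
    using V module_axioms by (auto simp: submodule_def Sub_iff module_vec_simps)
  then have sub: "VectorSpace.subspace class_ring V (module_vec TYPE('k) n)"
    using vectorspace_axioms by (simp add: VectorSpace.subspace_def)
  interpret W: vectorspace class_ring "module_vec TYPE('k) n\<lparr>carrier := V\<rparr>"
    by (rule subspace_is_vs[OF sub])
  have "lin_indpt (b ` P)"
  proof
    assume "lin_dep (b ` P)"
    then obtain a v where "lincomb a (b ` P) = 0\<^sub>v n" "v \<in> b ` P" "a v \<noteq> 0"
      using finite_lin_dep[of "b ` P"] finP bc by auto
    then show False using index P by (metis imageE index_zero_vec(1) lessThan_iff subsetD)
  qed
  moreover have "span (b ` P) = V"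
  proof
    show "span (b ` P) \<subseteq> V" by (rule span_is_subset[OF bV submod])
    show "V \<subseteq> span (b ` P)"
    proof
      fix v assume v: "v \<in> V"
      \<comment> \<open>Coefficients of \<open>lincomb\<close> are indexed by vectors, so
        \<open>inv_into P b\<close> recovers the pivot of a basis vector. By construction
        \<open>u\<close> agrees with \<open>v\<close> on \<open>P\<close>.\<close>
      define u where "u = lincomb (\<lambda>x. v $ (inv_into P b x)) (b ` P)"
      have u: "u \<in> span (b ` P)" using finP by (auto simp: span_def u_def)
      then have uV: "u \<in> V" using \<open>span (b ` P) \<subseteq> V\<close> by blast
      have "\<forall>p\<in>P. (v + (- 1) \<cdot>\<^sub>v u) $ p = 0"
        using index P Sub_dim[OF V uV] Sub_dim[OF V v] by (auto simp: u_def inj subset_iff)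
      then have "v + (- 1) \<cdot>\<^sub>v u = 0\<^sub>v n"
        using sep Sub_diff[OF V v uV] by (auto simp: separates_def)
      then have "(v + (- 1) \<cdot>\<^sub>v u) $ i = 0" if "i < n" for i using that by simp
      then have "v = u"
        using Sub_dim[OF V uV] Sub_dim[OF V v] by (intro eq_vecI) auto
      then show "v \<in> span (b ` P)" using u by simp
    qed
  qed
  ultimately have "W.basis (b ` P)"
    using span_li_not_depend[OF bV submod] bV by (simp add: W.basis_def)
  then show ?thesis
    using W.dim_basis[of "b ` P"] finP by (simp add: vdim_def card_image inj)
qed

section \<open>Places\<close>

lemma Sub_hull:
  assumes "X \<subseteq> carrier_vec n"
  shows "(\<lambda>M. M \<in> Sub (*) n) hull X \<in> Sub (*) n"
proof (rule SubI)
  show "v \<in> carrier_vec n" if "v \<in> (\<lambda>M. M \<in> Sub (*) n) hull X" for v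
    using that hull_minimal[OF assms, of "\<lambda>M. M \<in> Sub (*) n"] carrier_in_Sub by blast
qed (auto simp: hull_def Sub_zero Sub_add Sub_smult)

lemma Sub_sum:
  assumes V: "V \<in> Sub (*) n" and Q: "finite Q" and b: "\<And>p. p \<in> Q \<Longrightarrow> b p \<in> V"
  shows "vec n (\<lambda>i. \<Sum>p\<in>Q. c p * b p $ i) \<in> V"
  using Q b
proof (induction Q rule: finite_induct)
  case empty
  have "vec n (\<lambda>i. \<Sum>p\<in>{}. c p * b p $ i) = 0\<^sub>v n" by (intro eq_vecI) auto
  then show ?case using Sub_zero[OF V] by simp
next
  case (insert q Q)
  have "vec n (\<lambda>i. \<Sum>p\<in>insert q Q. c p * b p $ i)
      = c q \<cdot>\<^sub>v b q + vec n (\<lambda>i. \<Sum>p\<in>Q. c p * b p $ i)"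
    using insert Sub_dim[OF V, of "b q"] by (intro eq_vecI) auto
  then show ?case using insert V by (simp add: Sub_add Sub_smult)
qed

definition integral_vecs :: "'k set \<Rightarrow> 'k vec set \<Rightarrow> 'k vec set" where
  "integral_vecs R V = {v \<in> V. \<forall>i<dim_vec v. v $ i \<in> R}"

text \<open>The value of \<open>data_inflator\<close> with the residue map and the embedding merged
  into one map \<open>s\<close>. Only the values of \<open>s\<close> on \<open>R\<close> matter, so
  it also applies to a place extracted from an inflator, before any residue field is formed.\<close>

definition specialization ::
  "'k::field set \<Rightarrow> ('k \<Rightarrow> 'l::division_ring) \<Rightarrow> nat \<Rightarrow> 'k vec set \<Rightarrow> 'l vec set" where
  "specialization R s n V = (\<lambda>M. M \<in> Sub (*) n) hull (map_vec s ` integral_vecs R V)"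

locale valued_field =
  fixes R :: "'k::field set"
  assumes valuation: "valuation_ring R"
begin

abbreviation "\<O> \<equiv> class_ring\<lparr>carrier := R\<rparr>"

lemma subring_R: "subring R class_ring"
  using valuation by (simp add: valuation_ring_def)

lemma zero_R: "0 \<in> R" and one_R: "1 \<in> R"
  and uminus_R: "x \<in> R \<Longrightarrow> - x \<in> R"
  and add_R: "x \<in> R \<Longrightarrow> y \<in> R \<Longrightarrow> x + y \<in> R"
  and mult_R: "x \<in> R \<Longrightarrow> y \<in> R \<Longrightarrow> x * y \<in> R"
  using subringE(2,3,5,6,7)[OF subring_R] by (auto simp: class_ring_simps)

lemma inverse_R: "x \<notin> R \<Longrightarrow> inverse x \<in> R"
  using valuation by (auto simp: valuation_ring_def)

end

text \<open>
  The pair of a valuation ring and an embedding of its residue field is encoded by the composite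
  \<open>s\<close> of the residue map and the embedding.
\<close>

locale place = valued_field R for R :: "'k::field set" +
  fixes s :: "'k \<Rightarrow> 'l::division_ring"
  assumes s_one: "s 1 = 1"
    and s_add: "x \<in> R \<Longrightarrow> y \<in> R \<Longrightarrow> s (x + y) = s x + s y"
    and s_mult: "x \<in> R \<Longrightarrow> y \<in> R \<Longrightarrow> s (x * y) = s x * s y"
    and s_eq_0_iff: "x \<in> R \<Longrightarrow> s x = 0 \<longleftrightarrow> x \<in> max_ideal R"
begin

lemma sum_R: "(\<And>i. i \<in> I \<Longrightarrow> f i \<in> R) \<Longrightarrow> sum f I \<in> R"
  by (induction I rule: infinite_finite_induct) (auto simp: zero_R add_R)

lemma s_zero: "s 0 = 0"
  using s_eq_0_iff[OF zero_R] by (simp add: max_ideal_def zero_R)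

lemma s_sum: "(\<And>i. i \<in> I \<Longrightarrow> f i \<in> R) \<Longrightarrow> s (sum f I) = (\<Sum>i\<in>I. s (f i))"
  by (induction I rule: infinite_finite_induct) (auto simp: s_zero s_add sum_R)

lemma s_inverse_nonmember: "x \<notin> R \<Longrightarrow> s (inverse x) = 0"
  using s_eq_0_iff[OF inverse_R] inverse_R by (auto simp: max_ideal_def)

section \<open>Integral vectors, and the specialization of a subspace\<close>

lemma integral_vecs_R: "v \<in> integral_vecs R V \<Longrightarrow> i < dim_vec v \<Longrightarrow> v $ i \<in> R"
  by (simp add: integral_vecs_def)

lemma generators_carrier:
  "V \<in> Sub (*) n \<Longrightarrow> map_vec s ` integral_vecs R V \<subseteq> carrier_vec n"
  by (auto simp: integral_vecs_def Sub_iff)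

lemma specialization_in_Sub: "V \<in> Sub (*) n \<Longrightarrow> specialization R s n V \<in> Sub (*) n"
  unfolding specialization_def by (rule Sub_hull[OF generators_carrier])

lemma map_vec_in_specialization:
  "v \<in> integral_vecs R V \<Longrightarrow> map_vec s v \<in> specialization R s n V"
  unfolding specialization_def using hull_subset by fast

lemma specialization_subset:
  assumes "\<And>v. v \<in> integral_vecs R V \<Longrightarrow> map_vec s v \<in> W" "W \<in> Sub (*) n"
  shows "specialization R s n V \<subseteq> W"
  unfolding specialization_def using assms by (intro hull_minimal) auto

text \<open>An element of least valuation, phrased by divisibility: over a valuation ring
  divisibility is a total preorder, so a finite set has an element dividing all others.\<close>

lemma ex_dominating:
  assumes "finite X" "X \<noteq> {}" "0 \<notin> X"
  shows "\<exists>x\<in>X. \<forall>y\<in>X. inverse x * y \<in> R"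
  using assms
proof (induction X rule: finite_ne_induct)
  case (singleton x)
  then show ?case using one_R by simp
next
  case (insert z X)
  then obtain x where x: "x \<in> X" "\<forall>y\<in>X. inverse x * y \<in> R" by auto
  have nz: "x \<noteq> 0" "z \<noteq> 0" using insert x by auto
  show ?case
  proof (cases "inverse x * z \<in> R")
    case True
    then show ?thesis using x by auto
  next
    case False
    then have zx: "inverse z * x \<in> R" using inverse_R[of "inverse x * z"] nz by (simp add: mult.commute)
    have "inverse z * y \<in> R" if "y \<in> insert z X" for y
    proof (cases "y = z")
      case True
      then show ?thesis using nz one_R by simp
    next
      case False
      then have "(inverse z * x) * (inverse x * y) \<in> R" using that x zx mult_R by auto
      then show ?thesis using nz by (simp add: field_simps)
    qed
    then show ?thesis by blast
  qed
qed

text \<open>Division by a coordinate of least valuation; this produces the pivots of the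
  elimination.\<close>

lemma ex_primitive_multiple:
  assumes v: "v \<in> carrier_vec n" "v \<noteq> 0\<^sub>v n"
  obtains c i where "i < n" "c * v $ i = 1" "\<And>j. j < n \<Longrightarrow> c * v $ j \<in> R"
proof -
  define X where "X = {v $ j | j. j < n \<and> v $ j \<noteq> 0}"
  have "X \<noteq> {}" using nonzero_coordinate[OF v] by (auto simp: X_def)
  moreover have "finite X" by (auto simp: X_def)
  moreover have "0 \<notin> X" by (auto simp: X_def)
  ultimately obtain x where x: "x \<in> X" "\<forall>y\<in>X. inverse x * y \<in> R" using ex_dominating by blast
  then obtain i where i: "i < n" "x = v $ i" "x \<noteq> 0" by (auto simp: X_def)
  have "inverse x * v $ j \<in> R" if "j < n" for j
    using x that zero_R by (cases "v $ j = 0") (auto simp: X_def)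
  then show thesis using that[of i "inverse x"] i by auto
qed

text \<open>Gaussian elimination with a pivot of least valuation keeps all entries integral.\<close>

lemma ex_integral_dual_family:
  assumes V: "V \<in> Sub (*) n"
  obtains P b where "P \<subseteq> {..<n}" "dual_family P (integral_vecs R V) b" "separates P V n"
proof -
  \<comment> \<open>Maximality of the pivot set replaces an elimination loop: a nonzero vector of
    \<open>V\<close> vanishing on a maximal \<open>P\<close> would yield one more pivot.\<close>
  define S where "S = {P. P \<subseteq> {..<n} \<and> (\<exists>b. dual_family P (integral_vecs R V) b)}"
  have "finite S" by (rule finite_subset[of _ "Pow {..<n}"]) (auto simp: S_def)
  moreover have "{} \<in> S" by (auto simp: S_def dual_family_def)
  ultimately obtain P where P: "P \<in> S" "\<forall>Q\<in>S. P \<subseteq> Q \<longrightarrow> P = Q"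
    using finite_has_maximal[of S] by blast
  then obtain b where b: "P \<subseteq> {..<n}" "dual_family P (integral_vecs R V) b"
    by (auto simp: S_def)
  have "w = 0\<^sub>v n" if w: "w \<in> V" "\<forall>p\<in>P. w $ p = 0" for w
  proof (rule ccontr)
    assume "w \<noteq> 0\<^sub>v n"
    then obtain c i where c: "i < n" "c * w $ i = 1" "\<And>j. j < n \<Longrightarrow> c * w $ j \<in> R"
      by (rule ex_primitive_multiple[OF Sub_carrier[OF V w(1)]]) blast
    define u where "u = c \<cdot>\<^sub>v w"
    have dw: "dim_vec w = n" using Sub_dim[OF V] w by blast
    have u: "u \<in> V" "dim_vec u = n" "u $ i = 1" "\<And>j. j < n \<Longrightarrow> u $ j \<in> R"
      using c dw Sub_smult[OF V w(1)] by (simp_all add: u_def)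
    have uP: "u $ p = 0" if "p \<in> P" for p
    proof -
      have "p < n" using that b by auto
      then show ?thesis using that w dw by (simp add: u_def)
    qed
    have iP: "i \<notin> P" using u uP by auto
    have bp: "b p \<in> V" "dim_vec (b p) = n" "\<And>j. j < n \<Longrightarrow> b p $ j \<in> R"
      "\<And>q. q \<in> P \<Longrightarrow> b p $ q = (if p = q then 1 else 0)" if "p \<in> P" for p
      using b that Sub_dim[OF V] by (auto simp: dual_family_def integral_vecs_def)
    \<comment> \<open>The new pivot vector \<open>u\<close> vanishes on \<open>P\<close>, so
      subtracting multiples of it clears coordinate \<open>i\<close> and leaves the identity block
      on \<open>P\<close> untouched.\<close>
    define b' where "b' q = (if q = i then u else b q + (- (b q $ i)) \<cdot>\<^sub>v u)" for q
    have "dual_family (insert i P) (integral_vecs R V) b'"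
      unfolding dual_family_def
    proof (intro ballI conjI)
      fix p assume p: "p \<in> insert i P"
      show "b' p \<in> integral_vecs R V"
      proof (cases "p = i")
        case True
        then show ?thesis using u by (simp add: b'_def integral_vecs_def)
      next
        case False
        then have pP: "p \<in> P" using p by simp
        have "b' p \<in> V" using False Sub_diff[OF V bp(1)[OF pP] u(1)] by (simp add: b'_def)
        moreover have "b' p $ j \<in> R" if "j < n" for j
        proof -
          have "- (b p $ i) * u $ j \<in> R"
            by (rule mult_R[OF uminus_R[OF bp(3)[OF pP c(1)]] u(4)[OF that]])
          moreover have "b p $ j \<in> R" using bp(3)[OF pP that] .
          ultimately have "b p $ j + - (b p $ i) * u $ j \<in> R" by (intro add_R)
          then show ?thesis using False that bp(2)[OF pP] u(2) by (simp add: b'_def)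
        qed
        ultimately show ?thesis using Sub_dim[OF V, of "b' p"] by (simp add: integral_vecs_def)
      qed
      fix q assume q: "q \<in> insert i P"
      then have "q < n" using c b by auto
      then show "b' p $ q = (if p = q then 1 else 0)"
        using p q bp u uP iP by (auto simp: b'_def)
    qed
    then have "insert i P \<in> S" using b c by (auto simp: S_def)
    then show False using P iP by blast
  qed
  then show thesis using that[OF b] by (simp add: separates_def)
qed

lemma module_length_specialization:
  assumes V: "V \<in> Sub (*) n"
  shows "module_length (*) n (specialization R s n V) = enat (vdim n V)"
proof -
  obtain P b where P: "P \<subseteq> {..<n}" and b: "dual_family P (integral_vecs R V) b"
    and sep: "separates P V n" using ex_integral_dual_family[OF V] .
  have fin: "finite P" using P finite_subset by blast
  have Pn: "p < n" if "p \<in> P" for p using that P by auto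
  have bp: "b p \<in> V" "dim_vec (b p) = n" "\<And>j. j < n \<Longrightarrow> b p $ j \<in> R"
      "\<And>q. q \<in> P \<Longrightarrow> b p $ q = (if p = q then 1 else 0)" if "p \<in> P" for p
    using b that Sub_dim[OF V] by (auto simp: dual_family_def integral_vecs_def)
  have vdim: "vdim n V = card P"
    using b by (intro vdim_eq[OF V P sep, of b]) (auto simp: dual_family_def integral_vecs_def)
  \<comment> \<open>This is the left span of the vectors \<open>map_vec s (b p)\<close>, written so
    that the coefficients are the pivot coordinates of \<open>u\<close> itself. A vector of
    \<open>T\<close> that vanishes on \<open>P\<close> is then visibly zero, which gives separation
    for the specialization.\<close>
  define T where "T = {u \<in> carrier_vec n. \<forall>i<n. u $ i = (\<Sum>p\<in>P. u $ p * s (b p $ i))}"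
  have dim_T: "u \<in> carrier_vec n"
    and index_T: "i < n \<Longrightarrow> u $ i = (\<Sum>p\<in>P. u $ p * s (b p $ i))" if "u \<in> T" for u i
    using that unfolding T_def by blast+
  have T: "T \<in> Sub (*) n"
  proof (rule SubI)
    show "v \<in> carrier_vec n" if "v \<in> T" for v using that by (simp add: T_def)
    show "0\<^sub>v n \<in> T" using Pn by (auto simp: T_def)
    show "v + w \<in> T" if v: "v \<in> T" and w: "w \<in> T" for v w
      unfolding T_def mem_Collect_eq
    proof (intro conjI allI impI)
      show "v + w \<in> carrier_vec n" using dim_T v w by auto
      fix i assume i: "i < n"
      have "(v + w) $ i = (\<Sum>p\<in>P. v $ p * s (b p $ i)) + (\<Sum>p\<in>P. w $ p * s (b p $ i))"
        using index_T[OF v i] index_T[OF w i] dim_T v w i by (metis index_add_vec(1) carrier_vecD)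
      also have "\<dots> = (\<Sum>p\<in>P. (v + w) $ p * s (b p $ i))"
        unfolding sum.distrib[symmetric]
        using dim_T[OF v] dim_T[OF w] Pn by (intro sum.cong) (simp_all add: distrib_right)
      finally show "(v + w) $ i = (\<Sum>p\<in>P. (v + w) $ p * s (b p $ i))" .
    qed
    show "a \<cdot>\<^sub>v v \<in> T" if v: "v \<in> T" for a v
      unfolding T_def mem_Collect_eq
    proof (intro conjI allI impI)
      show "a \<cdot>\<^sub>v v \<in> carrier_vec n" using dim_T v by auto
      fix i assume i: "i < n"
      have "(a \<cdot>\<^sub>v v) $ i = a * (\<Sum>p\<in>P. v $ p * s (b p $ i))"
        using index_T[OF v i] dim_T[OF v] i by (metis index_smult_vec(1) carrier_vecD)
      also have "\<dots> = (\<Sum>p\<in>P. (a \<cdot>\<^sub>v v) $ p * s (b p $ i))"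
        unfolding sum_distrib_left
        using dim_T[OF v] Pn by (intro sum.cong) (simp_all add: mult.assoc)
      finally show "(a \<cdot>\<^sub>v v) $ i = (\<Sum>p\<in>P. (a \<cdot>\<^sub>v v) $ p * s (b p $ i))" .
    qed
  qed
  have "map_vec s v \<in> T" if v: "v \<in> integral_vecs R V" for v
  proof -
    have vV: "v \<in> V" and dv: "dim_vec v = n" and vR: "\<And>i. i < n \<Longrightarrow> v $ i \<in> R"
      using v Sub_dim[OF V] by (auto simp: integral_vecs_def)
    \<comment> \<open>By separation \<open>v\<close> equals its expansion \<open>u\<close>. The
      coefficients \<open>v $ p\<close> lie in \<open>R\<close>, so \<open>s\<close> may be applied
      summand by summand.\<close>
    define u where "u = vec n (\<lambda>i. \<Sum>p\<in>P. v $ p * b p $ i)"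
    have u: "u \<in> V" unfolding u_def using Sub_sum[OF V fin] bp(1) by blast
    have "u $ q = v $ q" if "q \<in> P" for q
    proof -
      have "u $ q = (\<Sum>p\<in>P. if p = q then v $ p else 0)"
        using that Pn by (auto simp: u_def bp intro!: sum.cong)
      then show ?thesis using that fin by simp
    qed
    then have "v + (- 1) \<cdot>\<^sub>v u = 0\<^sub>v n"
      using sep Sub_diff[OF V vV u] dv Pn by (auto simp: separates_def u_def)
    then have "(v + (- 1) \<cdot>\<^sub>v u) $ i = 0" if "i < n" for i using that by simp
    then have eq: "v $ i = (\<Sum>p\<in>P. v $ p * b p $ i)" if "i < n" for i
      using that dv by (auto simp: u_def)
    have s_eq: "s (v $ i) = (\<Sum>p\<in>P. s (v $ p) * s (b p $ i))" if "i < n" for i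
      using that Pn by (subst eq[OF that]) (auto simp: s_sum s_mult mult_R vR bp)
    show ?thesis
      unfolding T_def mem_Collect_eq
    proof (intro conjI allI impI)
      fix i assume i: "i < n"
      show "map_vec s v $ i = (\<Sum>p\<in>P. map_vec s v $ p * s (b p $ i))"
        using s_eq[OF i] i dv Pn by simp
    qed (use Sub_carrier[OF V vV] in simp)
  qed
  then have sub: "specialization R s n V \<subseteq> T" using T by (rule specialization_subset)
  have "separates P (specialization R s n V) n"
    unfolding separates_def
  proof (intro ballI impI)
    fix w assume "w \<in> specialization R s n V" "\<forall>p\<in>P. w $ p = 0"
    moreover from this have "w \<in> T" using sub by blast
    ultimately show "w = 0\<^sub>v n"
      using index_T[of w] dim_T[of w] by (intro eq_vecI) (metis (no_types, lifting) sum.neutral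
          mult_zero_left index_zero_vec, simp)
  qed
  moreover have "dual_family P (specialization R s n V) (\<lambda>p. map_vec s (b p))"
    using b bp Pn by (auto simp: dual_family_def s_one s_zero intro!: map_vec_in_specialization)
  ultimately show ?thesis
    using module_length_eq[OF specialization_in_Sub[OF V] P] vdim by simp
qed

end

section \<open>Actions of matrices over the base field\<close>

context K0_algebra
begin

text \<open>Matrix entries and scalars both multiply coordinates from the left, so
  \<open>central\<close> has to move one past the other.\<close>

lemma mat_smult_vec:
  assumes "A \<in> carrier_mat m n" "v \<in> carrier_vec n"
  shows "map_mat e A *\<^sub>v (a \<cdot>\<^sub>v v) = a \<cdot>\<^sub>v (map_mat e A *\<^sub>v v)"
proof (rule eq_vecI)
  fix i assume "i < dim_vec (a \<cdot>\<^sub>v (map_mat e A *\<^sub>v v))"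
  then have i: "i < m" using assms by simp
  have "e c * (a * x) = a * (e c * x)" for c x
    using central[of c a] by (simp flip: mult.assoc)
  then show "(map_mat e A *\<^sub>v (a \<cdot>\<^sub>v v)) $ i = (a \<cdot>\<^sub>v (map_mat e A *\<^sub>v v)) $ i"
    using i assms by (simp add: scalar_prod_def sum_distrib_left)
qed (use assms in simp)

lemma index_mat_vec:
  assumes "A \<in> carrier_mat m n" "v \<in> carrier_vec n" "i < m"
  shows "(map_mat e A *\<^sub>v v) $ i = (\<Sum>j<n. e (A $$ (i, j)) * v $ j)"
  using assms by (simp add: scalar_prod_def atLeast0LessThan)

lemma Act_Dir:
  assumes "A \<in> carrier_mat n n" "V \<in> Sub (*) n"
  shows "Act (Dir e (*)) n A V = (\<lambda>v. map_mat e A *\<^sub>v v) ` V"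
  unfolding Dir_def directory.simps
proof (rule image_cong[OF refl])
  fix v assume "v \<in> V"
  then have "v \<in> carrier_vec n" using assms Sub_carrier by blast
  then show "vec n (\<lambda>i. \<Sum>j<n. e (A $$ (i, j)) * v $ j) = map_mat e A *\<^sub>v v"
    using assms by (intro eq_vecI) (simp_all add: index_mat_vec del: index_mult_mat_vec)
qed

lemma mat_image_in_Sub:
  assumes A: "A \<in> carrier_mat m n" and V: "V \<in> Sub (*) n"
  shows "(\<lambda>v. map_mat e A *\<^sub>v v) ` V \<in> Sub (*) m"
proof (rule SubI)
  show "w \<in> carrier_vec m" if "w \<in> (\<lambda>v. map_mat e A *\<^sub>v v) ` V" for w
    using that A by (auto intro: carrier_vecI)
  show "0\<^sub>v m \<in> (\<lambda>v. map_mat e A *\<^sub>v v) ` V"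
    using A Sub_zero[OF V] by (intro image_eqI[of _ _ "0\<^sub>v n"] eq_vecI) auto
  show "u + w \<in> (\<lambda>v. map_mat e A *\<^sub>v v) ` V"
    if uw: "u \<in> (\<lambda>v. map_mat e A *\<^sub>v v) ` V" "w \<in> (\<lambda>v. map_mat e A *\<^sub>v v) ` V" for u w
  proof -
    obtain u' where u: "u' \<in> V" "u = map_mat e A *\<^sub>v u'" using uw(1) by (elim imageE) simp
    obtain w' where w: "w' \<in> V" "w = map_mat e A *\<^sub>v w'" using uw(2) by (elim imageE) simp
    have "u + w = map_mat e A *\<^sub>v (u' + w')"
      unfolding u w using A u w Sub_carrier[OF V]
      by (intro mult_add_distrib_mat_vec[symmetric]) auto
    then show ?thesis using Sub_add[OF V u(1) w(1)] by (rule image_eqI)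
  qed
  show "a \<cdot>\<^sub>v w \<in> (\<lambda>v. map_mat e A *\<^sub>v v) ` V" if w: "w \<in> (\<lambda>v. map_mat e A *\<^sub>v v) ` V" for a w
  proof -
    obtain w' where w': "w' \<in> V" "w = map_mat e A *\<^sub>v w'" using w by (elim imageE) simp
    have "a \<cdot>\<^sub>v w = map_mat e A *\<^sub>v (a \<cdot>\<^sub>v w')"
      unfolding w'(2) by (rule mat_smult_vec[OF A Sub_carrier[OF V w'(1)], symmetric])
    then show ?thesis using Sub_smult[OF V w'(1)] by (rule image_eqI)
  qed
qed

lemma mat_mult_mult_vec:
  assumes "A \<in> carrier_mat l m" "B \<in> carrier_mat m n" "v \<in> carrier_vec n"
  shows "map_mat e A *\<^sub>v (map_mat e B *\<^sub>v v) = map_mat e (A * B) *\<^sub>v v"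
  using assms mat_hom_mult[OF assms(1,2)] by (simp add: assoc_mult_mat_vec[of _ l m _ n])

end

lemma GL_inverse:
  assumes "A \<in> GL n"
  obtains B where "A \<in> carrier_mat n n" "B \<in> carrier_mat n n" "A * B = 1\<^sub>m n" "B * A = 1\<^sub>m n"
proof -
  have A: "A \<in> carrier_mat n n" using assms by (simp add: GL_def)
  obtain B where B: "A * B = 1\<^sub>m n" "B * A = 1\<^sub>m (dim_row B)"
    using assms A by (auto simp: GL_def invertible_mat_def inverts_mat_def)
  have "dim_col B = n" using B(1) by (metis index_mult_mat(3) index_one_mat(3))
  moreover have "dim_row B = n" using B(2) A by (metis carrier_matD(2) index_mult_mat(3) index_one_mat(3))
  ultimately show thesis using that[of B] A B by auto
qed

section \<open>The inflator of a place\<close>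

abbreviation oplus :: "'a vec set \<Rightarrow> 'a vec set \<Rightarrow> 'a vec set" where
  "oplus V W \<equiv> {v @\<^sub>v w | v w. v \<in> V \<and> w \<in> W}"

lemma Sort_Dir: "Sort (Dir e sc) = Sub sc"
  and Le_Dir: "Le (Dir e sc) = (\<subseteq>)"
  and Oplus_Dir: "Oplus (Dir e sc) = oplus"
  by (simp_all add: Dir_def)

lemma oplus_in_Sub:
  assumes V: "V \<in> Sub (*) n" and W: "W \<in> Sub (*) m"
  shows "oplus V W \<in> Sub (*) (n + m)"
proof (rule SubI)
  note dims = Sub_dim[OF V] Sub_dim[OF W]
  show "x \<in> carrier_vec (n + m)" if "x \<in> oplus V W" for x
    using that Sub_carrier[OF V] Sub_carrier[OF W] by auto
  have "0\<^sub>v (n + m) = 0\<^sub>v n @\<^sub>v 0\<^sub>v m" by (intro eq_vecI) auto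
  then show "0\<^sub>v (n + m) \<in> oplus V W" using Sub_zero[OF V] Sub_zero[OF W] by blast
  show "x + y \<in> oplus V W" if xy: "x \<in> oplus V W" "y \<in> oplus V W" for x y
  proof -
    obtain v w v' w' where *: "x = v @\<^sub>v w" "y = v' @\<^sub>v w'" "v \<in> V" "w \<in> W" "v' \<in> V" "w' \<in> W"
      using xy by blast
    then have "x + y = (v + v') @\<^sub>v (w + w')" using dims by (intro eq_vecI) auto
    then show ?thesis using * Sub_add[OF V] Sub_add[OF W] by blast
  qed
  show "a \<cdot>\<^sub>v x \<in> oplus V W" if x: "x \<in> oplus V W" for a x
  proof -
    obtain v w where *: "x = v @\<^sub>v w" "v \<in> V" "w \<in> W" using x by blast
    then have "a \<cdot>\<^sub>v x = (a \<cdot>\<^sub>v v) @\<^sub>v (a \<cdot>\<^sub>v w)" using dims by (intro eq_vecI) auto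
    then show ?thesis using * Sub_smult[OF V] Sub_smult[OF W] by blast
  qed
qed

context place
begin

lemma specialization_mono:
  assumes "V \<subseteq> W" shows "specialization R s n V \<subseteq> specialization R s n W"
  unfolding specialization_def using assms by (intro hull_mono) (auto simp: integral_vecs_def)

text \<open>Membership in a hull is tested on generators: the preimage of a submodule under the
  left-linear map \<open>h\<close> is a submodule.\<close>

lemma specialization_map:
  assumes V: "V \<in> Sub (*) n" and W: "W \<in> Sub (*) m"
    and gen: "\<And>v. v \<in> integral_vecs R V \<Longrightarrow> h (map_vec s v) \<in> specialization R s m W"
    and zero: "h (0\<^sub>v n) = 0\<^sub>v m"
    and add: "\<And>u v. u \<in> carrier_vec n \<Longrightarrow> v \<in> carrier_vec n \<Longrightarrow> h (u + v) = h u + h v"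
    and smult: "\<And>a u. u \<in> carrier_vec n \<Longrightarrow> h (a \<cdot>\<^sub>v u) = a \<cdot>\<^sub>v h u"
    and u: "u \<in> specialization R s n V"
  shows "h u \<in> specialization R s m W"
proof -
  note S = specialization_in_Sub[OF W]
  have "{u \<in> carrier_vec n. h u \<in> specialization R s m W} \<in> Sub (*) n"
    by (rule SubI) (auto simp: zero add smult Sub_zero[OF S] Sub_add[OF S] Sub_smult[OF S])
  then have "specialization R s n V \<subseteq> {u \<in> carrier_vec n. h u \<in> specialization R s m W}"
    using gen generators_carrier[OF V] by (intro specialization_subset) auto
  then show ?thesis using u by blast
qed

text \<open>An integral vector of the sum splits into integral parts. Conversely, elements of a hull
  need not be images of integral vectors, so each summand is embedded separately by padding with
  zeros, and the results are added.\<close>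

lemma specialization_oplus:
  assumes V: "V \<in> Sub (*) n" and W: "W \<in> Sub (*) m"
  shows "specialization R s (n + m) (oplus V W)
    = oplus (specialization R s n V) (specialization R s m W)" (is "?L = ?R")
proof
  have VW: "oplus V W \<in> Sub (*) (n + m)" using oplus_in_Sub[OF V W] .
  have L: "?L \<in> Sub (*) (n + m)" using specialization_in_Sub[OF VW] .
  have map_append: "map_vec s (v @\<^sub>v w) = map_vec s v @\<^sub>v map_vec s w" for v w
    by (intro eq_vecI) auto
  show "?L \<subseteq> ?R"
  proof (rule specialization_subset)
    fix x assume x: "x \<in> integral_vecs R (oplus V W)"
    then obtain v w where vw: "x = v @\<^sub>v w" "v \<in> V" "w \<in> W" by (auto simp: integral_vecs_def)
    have "v $ i \<in> R" if "i < dim_vec v" for i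
      using integral_vecs_R[OF x, of i] that by (simp add: vw)
    moreover have "w $ i \<in> R" if "i < dim_vec w" for i
      using integral_vecs_R[OF x, of "dim_vec v + i"] that by (simp add: vw)
    ultimately have "v \<in> integral_vecs R V" "w \<in> integral_vecs R W"
      using vw by (auto simp: integral_vecs_def)
    then have "map_vec s v \<in> specialization R s n V" "map_vec s w \<in> specialization R s m W"
      using map_vec_in_specialization by auto
    then show "map_vec s x \<in> ?R" unfolding vw(1) map_append by blast
  qed (intro oplus_in_Sub specialization_in_Sub V W)
  have 1: "u @\<^sub>v 0\<^sub>v m \<in> ?L" if "u \<in> specialization R s n V" for u
  proof (rule specialization_map[OF V VW _ _ _ _ that])
    fix v assume v: "v \<in> integral_vecs R V"
    have "v @\<^sub>v 0\<^sub>v m \<in> integral_vecs R (oplus V W)"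
      using v Sub_zero[OF W] zero_R by (auto simp: integral_vecs_def)
    then have "map_vec s (v @\<^sub>v 0\<^sub>v m) \<in> ?L" by (rule map_vec_in_specialization)
    moreover have "map_vec s (v @\<^sub>v 0\<^sub>v m) = map_vec s v @\<^sub>v 0\<^sub>v m"
      by (intro eq_vecI) (auto simp: s_zero)
    ultimately show "map_vec s v @\<^sub>v 0\<^sub>v m \<in> ?L" by simp
  qed (intro eq_vecI; auto)+
  have 2: "0\<^sub>v n @\<^sub>v u \<in> ?L" if "u \<in> specialization R s m W" for u
  proof (rule specialization_map[OF W VW _ _ _ _ that])
    fix w assume w: "w \<in> integral_vecs R W"
    have "0\<^sub>v n @\<^sub>v w \<in> integral_vecs R (oplus V W)"
      using w Sub_zero[OF V] zero_R by (auto simp: integral_vecs_def)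
    then have "map_vec s (0\<^sub>v n @\<^sub>v w) \<in> ?L" by (rule map_vec_in_specialization)
    moreover have "map_vec s (0\<^sub>v n @\<^sub>v w) = 0\<^sub>v n @\<^sub>v map_vec s w"
      by (intro eq_vecI) (auto simp: s_zero)
    ultimately show "0\<^sub>v n @\<^sub>v map_vec s w \<in> ?L" by simp
  qed (intro eq_vecI; auto)+
  show "?R \<subseteq> ?L"
  proof clarify
    fix u w assume *: "u \<in> specialization R s n V" "w \<in> specialization R s m W"
    then have "u \<in> carrier_vec n" "w \<in> carrier_vec m"
      using Sub_carrier[OF specialization_in_Sub[OF V]] Sub_carrier[OF specialization_in_Sub[OF W]]
      by blast+
    then have "(u @\<^sub>v 0\<^sub>v m) + (0\<^sub>v n @\<^sub>v w) = u @\<^sub>v w" by (intro eq_vecI) auto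
    then show "u @\<^sub>v w \<in> ?L" using Sub_add[OF L 1[OF *(1)] 2[OF *(2)]] by simp
  qed
qed

text \<open>The entries of \<open>A\<close> are sent into \<open>R\<close>, so the action preserves
  integral vectors, and \<open>s\<close> intertwines the actions over \<open>K\<close> and
  \<open>L\<close>.\<close>

lemma specialization_mat:
  fixes eK :: "'k0::field \<Rightarrow> 'k" and eL :: "'k0 \<Rightarrow> 'l"
  assumes K: "K0_algebra eK" and L: "K0_algebra eL"
    and eR: "range eK \<subseteq> R" and s_e: "\<And>c. s (eK c) = eL c"
    and A: "A \<in> carrier_mat m n" and V: "V \<in> Sub (*) n"
    and u: "u \<in> specialization R s n V"
  shows "map_mat eL A *\<^sub>v u \<in> specialization R s m ((\<lambda>v. map_mat eK A *\<^sub>v v) ` V)"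
proof -
  interpret K: K0_algebra eK by (rule K)
  interpret L: K0_algebra eL by (rule L)
  let ?W = "specialization R s m ((\<lambda>v. map_mat eK A *\<^sub>v v) ` V)"
  show ?thesis
  proof (rule specialization_map[OF V K.mat_image_in_Sub[OF A V] _ _ _ _ u])
    fix v assume v: "v \<in> integral_vecs R V"
    then have vV: "v \<in> V" by (simp add: integral_vecs_def)
    then have vc: "v \<in> carrier_vec n" using Sub_carrier[OF V] by blast
    then have vR: "v $ i \<in> R" if "i < n" for i using integral_vecs_R[OF v, of i] that by simp
    have R: "eK (A $$ (i, j)) * v $ j \<in> R" if "j < n" for i j
      using that eR vR by (intro mult_R) auto
    have "(map_mat eK A *\<^sub>v v) $ i \<in> R" if "i < m" for i
      unfolding K.index_mat_vec[OF A vc that] using R by (intro sum_R) auto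
    then have "map_mat eK A *\<^sub>v v \<in> integral_vecs R ((\<lambda>v. map_mat eK A *\<^sub>v v) ` V)"
      using A vV by (simp add: integral_vecs_def)
    moreover have "map_vec s (map_mat eK A *\<^sub>v v) = map_mat eL A *\<^sub>v map_vec s v"
    proof (rule eq_vecI)
      fix i assume "i < dim_vec (map_mat eL A *\<^sub>v map_vec s v)"
      then have i: "i < m" using A by simp
      have "s ((map_mat eK A *\<^sub>v v) $ i) = (\<Sum>j<n. s (eK (A $$ (i, j)) * v $ j))"
        unfolding K.index_mat_vec[OF A vc i] using R by (intro s_sum) auto
      also have "\<dots> = (\<Sum>j<n. eL (A $$ (i, j)) * map_vec s v $ j)"
        using vc s_mult[OF subsetD[OF eR rangeI] vR] by (intro sum.cong) (simp_all add: s_e)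
      also have "\<dots> = (map_mat eL A *\<^sub>v map_vec s v) $ i"
        using L.index_mat_vec[OF A _ i, of "map_vec s v"] vc by simp
      finally show "map_vec s (map_mat eK A *\<^sub>v v) $ i = (map_mat eL A *\<^sub>v map_vec s v) $ i"
        using i A by simp
    qed (use A in simp)
    ultimately show "map_mat eL A *\<^sub>v map_vec s v \<in> ?W" by (metis map_vec_in_specialization)
  next
    show "map_mat eL A *\<^sub>v 0\<^sub>v n = 0\<^sub>v m" using A by (intro eq_vecI) auto
  next
    show "map_mat eL A *\<^sub>v (v + w) = map_mat eL A *\<^sub>v v + map_mat eL A *\<^sub>v w"
      if "v \<in> carrier_vec n" "w \<in> carrier_vec n" for v w
      using A that by (intro mult_add_distrib_mat_vec) auto
  qed (rule L.mat_smult_vec[OF A])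
qed

text \<open>The inclusion for \<open>A\<close> is combined with the one for its inverse
  \<open>B\<close>.\<close>

lemma specialization_GL:
  fixes eK :: "'k0::field \<Rightarrow> 'k" and eL :: "'k0 \<Rightarrow> 'l"
  assumes K: "K0_algebra eK" and L: "K0_algebra eL"
    and eR: "range eK \<subseteq> R" and s_e: "\<And>c. s (eK c) = eL c"
    and A: "A \<in> GL n" and V: "V \<in> Sub (*) n"
  shows "specialization R s n ((\<lambda>v. map_mat eK A *\<^sub>v v) ` V)
    = (\<lambda>u. map_mat eL A *\<^sub>v u) ` specialization R s n V"
proof
  interpret K: K0_algebra eK by (rule K)
  interpret L: K0_algebra eL by (rule L)
  obtain B where AB: "A \<in> carrier_mat n n" "B \<in> carrier_mat n n" "A * B = 1\<^sub>m n" "B * A = 1\<^sub>m n"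
    using GL_inverse[OF A] .
  let ?AV = "(\<lambda>v. map_mat eK A *\<^sub>v v) ` V"
  note mat = specialization_mat[OF K L eR s_e]
  have AV: "?AV \<in> Sub (*) n" by (rule K.mat_image_in_Sub[OF AB(1) V])
  have BAV: "(\<lambda>v. map_mat eK B *\<^sub>v v) ` ?AV = V"
  proof -
    have "map_mat eK B *\<^sub>v (map_mat eK A *\<^sub>v v) = v" if "v \<in> V" for v
      using K.mat_mult_mult_vec[OF AB(2,1) Sub_carrier[OF V that]] Sub_carrier[OF V that]
      by (simp add: AB K.mat_hom_one)
    then show ?thesis by (simp add: image_image)
  qed
  show "specialization R s n ?AV \<subseteq> (\<lambda>u. map_mat eL A *\<^sub>v u) ` specialization R s n V"
  proof
    fix u assume u: "u \<in> specialization R s n ?AV"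
    then have uc: "u \<in> carrier_vec n" using Sub_carrier[OF specialization_in_Sub[OF AV]] by blast
    have "map_mat eL B *\<^sub>v u \<in> specialization R s n V" using mat[OF AB(2) AV u] by (simp add: BAV)
    moreover have "map_mat eL A *\<^sub>v (map_mat eL B *\<^sub>v u) = u"
      using L.mat_mult_mult_vec[OF AB(1,2) uc] uc by (simp add: AB L.mat_hom_one)
    ultimately show "u \<in> (\<lambda>u. map_mat eL A *\<^sub>v u) ` specialization R s n V"
      by (metis image_eqI)
  qed
  show "(\<lambda>u. map_mat eL A *\<^sub>v u) ` specialization R s n V \<subseteq> specialization R s n ?AV"
    using mat[OF AB(1) V] by auto
qed

lemma inflator_specialization:
  fixes eK :: "'k0::field \<Rightarrow> 'k" and eL :: "'k0 \<Rightarrow> 'l"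
  assumes K: "K0_algebra eK" and L: "K0_algebra eL"
    and eR: "range eK \<subseteq> R" and s_e: "\<And>c. s (eK c) = eL c"
  shows "inflator 1 eK eL (*) (\<lambda>n\<in>{1..}. \<lambda>V\<in>Sub (*) n. specialization R s n V)"
proof -
  interpret K: K0_algebra eK by (rule K)
  interpret L: K0_algebra eL by (rule L)
  let ?f = "\<lambda>n\<in>{1..}. \<lambda>V\<in>Sub (*) n. specialization R s n V"
  have "directory_morphism (Dir eK (*)) (Dir eL (*)) ?f"
    unfolding directory_morphism_def Sort_Dir Le_Dir Oplus_Dir
  proof (intro conjI ballI allI impI)
    show "?f \<in> (\<Pi>\<^sub>E n\<in>{1..}. Sub (*) n \<rightarrow>\<^sub>E Sub (*) n)"
      using specialization_in_Sub by auto
  next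
    fix n and V W :: "'k vec set" assume "1 \<le> n" "V \<in> Sub (*) n" "W \<in> Sub (*) n" "V \<subseteq> W"
    then show "?f n V \<subseteq> ?f n W" using specialization_mono by simp
  next
    fix n and A :: "'k0 mat" and V :: "'k vec set" assume n: "1 \<le> n" and A: "A \<in> GL n" and V: "V \<in> Sub (*) n"
    have Ac: "A \<in> carrier_mat n n" using A by (simp add: GL_def)
    show "?f n (Act (Dir eK (*)) n A V) = Act (Dir eL (*)) n A (?f n V)"
      using specialization_GL[OF K L eR s_e A V] K.mat_image_in_Sub[OF Ac V] n V
      by (simp add: K.Act_Dir[OF Ac V] L.Act_Dir[OF Ac specialization_in_Sub[OF V]])
  next
    fix n m and V W :: "'k vec set" assume "1 \<le> n" "1 \<le> m" "V \<in> Sub (*) n" "W \<in> Sub (*) m"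
    then show "?f (n + m) (oplus V W) = oplus (?f n V) (?f m W)"
      using oplus_in_Sub[of V n W m] specialization_oplus[of V n W m] by simp
  qed
  then show ?thesis
    using semisimple_division_ring module_length_specialization by (simp add: inflator_def)
qed

end

section \<open>Places and embeddings of residue fields\<close>

lemma specialization_cong:
  assumes "\<And>x. x \<in> R \<Longrightarrow> s x = s' x"
  shows "specialization R s = specialization R s'"
proof -
  have "map_vec s ` integral_vecs R V = map_vec s' ` integral_vecs R V" for V
    using assms by (intro image_cong[OF refl] eq_vecI) (auto simp: integral_vecs_def)
  then show ?thesis by (intro ext) (simp add: specialization_def)
qed

lemma data_inflator_eq:
  "data_inflator R \<phi> = (\<lambda>n\<in>{1..}. \<lambda>V\<in>Sub (*) n. specialization R (\<phi> \<circ> residue R) n V)"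
proof -
  have "map_vec \<phi> (map_vec (residue R) v) = map_vec (\<phi> \<circ> residue R) v" for v
    by (intro eq_vecI) auto
  then have "map_vec \<phi> ` reduction R V = map_vec (\<phi> \<circ> residue R) ` integral_vecs R V" for V
    by (simp add: reduction_def integral_vecs_def image_image)
  then show ?thesis by (simp add: data_inflator_def specialization_def)
qed

section \<open>The maximal ideal and the residue field\<close>

context valued_field
begin

lemma max_ideal_mult:
  assumes x: "x \<in> max_ideal R" and y: "y \<in> R"
  shows "y * x \<in> max_ideal R"
proof (cases "x = 0 \<or> y = 0")
  case True
  then show ?thesis using zero_R by (auto simp: max_ideal_def)
next
  case False
  have "inverse (y * x) \<notin> R"
  proof
    assume "inverse (y * x) \<in> R"
    then have "y * inverse (y * x) \<in> R" by (rule mult_R[OF y])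
    then show False using x False by (simp add: max_ideal_def field_simps)
  qed
  then show ?thesis using x y by (simp add: max_ideal_def mult_R)
qed

text \<open>Of two nonzero elements one divides the other, and the sum is then an integral multiple
  of the divisor.\<close>

lemma max_ideal_add:
  assumes x: "x \<in> max_ideal R" and y: "y \<in> max_ideal R"
  shows "x + y \<in> max_ideal R"
proof -
  have *: "a + b \<in> max_ideal R" if "a \<in> max_ideal R" "a \<noteq> 0" "inverse a * b \<in> R" for a b
  proof -
    have "(1 + inverse a * b) * a \<in> max_ideal R" using that max_ideal_mult add_R one_R by blast
    moreover have "(1 + inverse a * b) * a = a + b" using that by (simp add: field_simps)
    ultimately show ?thesis by simp
  qed
  show ?thesis
  proof (cases "x = 0 \<or> y = 0")
    case True
    then show ?thesis using x y by auto
  next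
    case False
    show ?thesis
    proof (cases "inverse x * y \<in> R")
      case True
      then show ?thesis using * x False by blast
    next
      case F: False
      then have "inverse y * x \<in> R" using inverse_R[of "inverse x * y"] by (simp add: mult.commute)
      then show ?thesis using *[of y x] y False by (simp add: add.commute)
    qed
  qed
qed

lemma ring_O: "ring \<O>"
  using ring.subring_is_ring[OF class_ring.ring_axioms subring_R] .

lemma max_ideal_ideal: "ideal (max_ideal R) \<O>"
proof (rule idealI[OF ring_O])
  have z: "0 \<in> max_ideal R" using zero_R by (simp add: max_ideal_def)
  have m: "- x \<in> max_ideal R" if "x \<in> max_ideal R" for x
    using max_ideal_mult[OF that uminus_R[OF one_R]] by simp
  show "subgroup (max_ideal R) (add_monoid \<O>)"
  proof (rule group.subgroupI)
    show "Group.group (add_monoid \<O>)"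
      using abelian_group.a_group[OF ring.is_abelian_group[OF ring_O]] .
    show "max_ideal R \<subseteq> carrier (add_monoid \<O>)" by (auto simp: max_ideal_def)
    show "max_ideal R \<noteq> {}" using z by blast
    show "inv\<^bsub>add_monoid \<O>\<^esub> a \<in> max_ideal R" if "a \<in> max_ideal R" for a
    proof -
      have "inv\<^bsub>add_monoid \<O>\<^esub> a = - a"
        using that m uminus_R
        by (intro comm_monoid.comm_inv_char
            [OF abelian_monoid.a_comm_monoid[OF abelian_group.axioms(1)[OF ring.is_abelian_group[OF ring_O]]]])
          (auto simp: max_ideal_def)
      then show ?thesis using m that by simp
    qed
    show "a \<otimes>\<^bsub>add_monoid \<O>\<^esub> b \<in> max_ideal R" if "a \<in> max_ideal R" "b \<in> max_ideal R" for a b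
      using that max_ideal_add by simp
  qed
  show "x \<otimes>\<^bsub>\<O>\<^esub> a \<in> max_ideal R" "a \<otimes>\<^bsub>\<O>\<^esub> x \<in> max_ideal R"
    if "a \<in> max_ideal R" "x \<in> carrier \<O>" for a x
    using that max_ideal_mult by (simp_all add: mult.commute)
qed

lemma residue_hom: "residue R \<in> Ring.ring_hom \<O> (residue_field R)"
  using ideal.rcos_ring_hom[OF max_ideal_ideal] by (simp add: residue_def[abs_def] residue_field_def)

lemma carrier_residue_field: "carrier (residue_field R) = residue R ` R"
  by (auto simp: residue_field_def residue_def[abs_def] FactRing_def A_RCOSETS_def')

lemma residue_eq: "residue R x = {h + x | h. h \<in> max_ideal R}"
  by (auto simp: residue_def a_r_coset_def')

lemma residue_eq_zero_iff:
  assumes "x \<in> R" shows "residue R x = residue R 0 \<longleftrightarrow> x \<in> max_ideal R"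
proof
  have z: "0 \<in> max_ideal R" using zero_R by (simp add: max_ideal_def)
  show "x \<in> max_ideal R" if "residue R x = residue R 0"
  proof -
    have "x \<in> residue R x" using z by (force simp: residue_eq)
    then have "x \<in> residue R 0" unfolding that .
    then show ?thesis by (simp add: residue_eq)
  qed
  show "residue R x = residue R 0" if x: "x \<in> max_ideal R"
  proof
    show "residue R x \<subseteq> residue R 0" using x max_ideal_add by (auto simp: residue_eq)
    have "- x \<in> max_ideal R" using max_ideal_mult[OF x uminus_R[OF one_R]] by simp
    then have "h + - x \<in> max_ideal R" if "h \<in> max_ideal R" for h using that max_ideal_add by blast
    then show "residue R 0 \<subseteq> residue R x" by (force simp: residue_eq)
  qed
qed

end

lemma valuation_data_imp_place:
  fixes eK :: "'k0::field \<Rightarrow> 'k::field" and eL :: "'k0 \<Rightarrow> 'l::division_ring"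
  assumes "(R, \<phi>) \<in> valuation_data eK eL"
  shows "place R (\<phi> \<circ> residue R)"
proof -
  have val: "valuation_ring R" and \<phi>: "\<phi> \<in> Ring.ring_hom (residue_field R) class_ring"
    and inj: "inj_on \<phi> (carrier (residue_field R))"
    using assms by (auto simp: valuation_data_def)
  interpret valued_field R by unfold_locales (rule val)
  have h: "\<phi> \<circ> residue R \<in> Ring.ring_hom \<O> class_ring"
    using ring_hom_trans[OF residue_hom \<phi>] .
  have add: "(\<phi> \<circ> residue R) (x + y) = (\<phi> \<circ> residue R) x + (\<phi> \<circ> residue R) y"
    if "x \<in> R" "y \<in> R" for x y using ring_hom_add[OF h] that by simp
  have zero: "(\<phi> \<circ> residue R) 0 = 0" using add[OF zero_R zero_R] by simp
  show ?thesis
  proof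
    show "(\<phi> \<circ> residue R) 1 = 1" using ring_hom_one[OF h] by simp
    show "(\<phi> \<circ> residue R) (x * y) = (\<phi> \<circ> residue R) x * (\<phi> \<circ> residue R) y"
      if "x \<in> R" "y \<in> R" for x y using ring_hom_mult[OF h] that by simp
    show "(\<phi> \<circ> residue R) x = 0 \<longleftrightarrow> x \<in> max_ideal R" if x: "x \<in> R" for x
    proof -
      have "(\<phi> \<circ> residue R) x = 0 \<longleftrightarrow> \<phi> (residue R x) = \<phi> (residue R 0)" using zero by simp
      also have "\<dots> \<longleftrightarrow> residue R x = residue R 0"
        using inj x zero_R by (intro inj_on_eq_iff) (auto simp: carrier_residue_field)
      finally show ?thesis using residue_eq_zero_iff[OF x] by simp
    qed
  qed (rule add)
qed

text \<open>The first isomorphism theorem: \<open>s\<close> has kernel \<open>max_ideal R\<close>,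
  so it is constant on cosets and its value there, taken by \<open>the_elem\<close>, is an embedding
  of the quotient. Restriction to the carrier meets the extensionality demanded by
  \<open>valuation_data\<close>.\<close>

lemma (in place) ex_valuation_data:
  fixes eK :: "'k0::field \<Rightarrow> 'k" and eL :: "'k0 \<Rightarrow> 'l"
  assumes eR: "range eK \<subseteq> R" and s_e: "\<And>c. s (eK c) = eL c"
  obtains \<phi> where "(R, \<phi>) \<in> valuation_data eK eL" "\<And>x. x \<in> R \<Longrightarrow> \<phi> (residue R x) = s x"
proof -
  have "s \<in> Ring.ring_hom \<O> class_ring"
    by (rule ring_hom_memI) (auto simp: s_add s_mult s_one)
  then have h: "ring_hom_ring \<O> (class_ring :: 'l ring) s"
    by (rule ring_hom_ringI2[OF ring_O class_ring.ring_axioms])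
  have ker: "a_kernel \<O> (class_ring :: 'l ring) s = max_ideal R"
    using s_eq_0_iff by (auto simp: a_kernel_def' max_ideal_def)
  define \<psi> where "\<psi> X = the_elem (s ` X)" for X
  define \<phi> where "\<phi> = restrict \<psi> (carrier (residue_field R))"
  have "\<psi> (residue R x) = s x" if "x \<in> R" for x
    using ring_hom_ring.the_elem_simp[OF h, of x, unfolded ker] that
    by (simp add: \<psi>_def residue_def)
  then have \<phi>_res: "\<phi> (residue R x) = s x" if "x \<in> R" for x
    using that by (simp add: \<phi>_def carrier_residue_field)
  have field: "residue_field R = \<O> Quot (a_kernel \<O> (class_ring :: 'l ring) s)"
    unfolding residue_field_def ker ..
  have "inj_on \<phi> (carrier (residue_field R))"
  proof (rule inj_onI)
    fix X Y assume "X \<in> carrier (residue_field R)" "Y \<in> carrier (residue_field R)" "\<phi> X = \<phi> Y"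
    then show "X = Y"
      using ring_hom_ring.the_elem_inj[OF h, of X Y] by (simp add: \<phi>_def \<psi>_def field)
  qed
  moreover have "\<phi> \<in> Ring.ring_hom (residue_field R) class_ring"
  proof -
    have F: "ring (residue_field R)"
      unfolding residue_field_def by (rule ideal.quotient_is_ring[OF max_ideal_ideal])
    have \<psi>: "\<psi> \<in> Ring.ring_hom (residue_field R) class_ring"
      using ring_hom_ring.the_elem_hom[OF h] unfolding field[symmetric] \<psi>_def .
    show ?thesis
      using ring_hom_mult[OF \<psi>] ring_hom_add[OF \<psi>] ring_hom_one[OF \<psi>]
        ring.ring_simprules(1,5,6)[OF F]
      by (intro ring_hom_memI) (simp_all add: \<phi>_def)
  qed
  ultimately have "(R, \<phi>) \<in> valuation_data eK eL"
    using valuation eR s_e \<phi>_res by (auto simp: valuation_data_def \<phi>_def subset_iff)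
  then show thesis using that \<phi>_res by blast
qed

section \<open>Recovering a place from its inflator\<close>

abbreviation vec2 :: "'a \<Rightarrow> 'a \<Rightarrow> 'a vec" where
  "vec2 a b \<equiv> vCons a (vCons b vNil)"

lemma vec2_carrier: "vec2 a b \<in> carrier_vec 2"
  by (rule carrier_vecI) simp

lemma index_vec2: "vec2 a b $ 0 = a" "vec2 a b $ 1 = b"
  by (simp_all add: vCons_def)

lemma vec2_eqI:
  assumes v: "v \<in> carrier_vec 2" and a: "v $ 0 = a" and b: "v $ 1 = b"
  shows "v = vec2 a b"
proof (rule eq_vecI)
  fix i assume "i < dim_vec (vec2 a b)"
  then have "i = 0 \<or> i = 1" by auto
  then show "v $ i = vec2 a b $ i" using a b index_vec2[of a b] by metis
qed (use v in simp)

context place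
begin

lemma graph_in_specialization:
  assumes "a \<in> R"
  shows "vec2 1 (s a) \<in> specialization R s 2 (line (vec2 1 a))"
proof -
  have "vec2 1 a \<in> integral_vecs R (line (vec2 1 a))"
    using assms one_R by (auto simp: integral_vecs_def line_self less_Suc_eq index_vec2)
  moreover have "map_vec s (vec2 1 a) = vec2 1 (s a)"
    by (rule vec2_eqI) (auto simp: index_vec2 s_one intro: carrier_vecI)
  ultimately show ?thesis using map_vec_in_specialization by metis
qed

text \<open>Generators have the form \<open>(s x, s (x * a))\<close> with \<open>x\<close> and
  \<open>x * a\<close> in \<open>R\<close>. If \<open>a\<close> is not in \<open>R\<close>, then
  \<open>x = (x * a) * inverse a\<close>, and \<open>s\<close> kills
  \<open>inverse a\<close>.\<close>

lemma specialization_graph: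
  assumes w: "w \<in> specialization R s 2 (line (vec2 1 a))"
  shows "a \<in> R \<Longrightarrow> w $ 1 = w $ 0 * s a" and "a \<notin> R \<Longrightarrow> w $ 0 = 0"
proof -
  have gen: "\<exists>x. x \<in> R \<and> x * a \<in> R \<and> map_vec s v $ 0 = s x \<and> map_vec s v $ 1 = s (x * a)"
    if v: "v \<in> integral_vecs R (line (vec2 1 a))" for v
  proof -
    obtain x where x: "v = x \<cdot>\<^sub>v vec2 1 a" using v by (auto simp: integral_vecs_def line_def)
    have "v $ 0 = x" "v $ 1 = x * a" "dim_vec v = 2"
      unfolding x by (simp_all add: index_vec2)
    moreover from this have "v $ 0 \<in> R" "v $ 1 \<in> R"
      using integral_vecs_R[OF v, of 0] integral_vecs_R[OF v, of 1] by simp_all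
    ultimately show ?thesis by (intro exI[of _ x]) simp
  qed
  have carrier: "map_vec s v \<in> carrier_vec 2" if "v \<in> integral_vecs R (line (vec2 1 a))" for v
    using generators_carrier[OF line_in_Sub[OF vec2_carrier]] that by blast
  show "w $ 1 = w $ 0 * s a" if a: "a \<in> R"
  proof -
    have "{u \<in> carrier_vec 2. u $ 1 = u $ 0 * s a} \<in> Sub (*) 2"
      by (rule SubI) (auto simp: distrib_right mult.assoc)
    then have "specialization R s 2 (line (vec2 1 a)) \<subseteq> {u \<in> carrier_vec 2. u $ 1 = u $ 0 * s a}"
      using gen carrier s_mult[OF _ a] by (intro specialization_subset) (fastforce, simp)
    then show ?thesis using w by blast
  qed
  show "w $ 0 = 0" if a: "a \<notin> R"
  proof -
    have "{u \<in> carrier_vec 2. u $ 0 = (0::'l)} \<in> Sub (*) 2"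
      by (rule SubI) auto
    moreover have "s x = 0" if "x \<in> R" "x * a \<in> R" for x
    proof -
      have "a \<noteq> 0" using a zero_R by auto
      then have "x = (x * a) * inverse a" by simp
      then have "s x = s (x * a) * s (inverse a)" using s_mult[OF that(2) inverse_R[OF a]] by metis
      then show ?thesis using s_inverse_nonmember[OF a] by simp
    qed
    ultimately have "specialization R s 2 (line (vec2 1 a)) \<subseteq> {u \<in> carrier_vec 2. u $ 0 = 0}"
      using gen carrier by (intro specialization_subset) (fastforce, simp)
    then show ?thesis using w by blast
  qed
qed

text \<open>The right-hand side depends on the specialization map alone, so the inflator determines
  \<open>R\<close>. The same formula later defines \<open>residue_ring\<close> for an arbitrary
  inflator.\<close>

lemma R_eq: "R = {a. \<exists>w\<in>specialization R s 2 (line (vec2 1 a)). w $ 0 \<noteq> 0}"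
proof (intro subset_antisym subsetI)
  fix a assume "a \<in> R"
  from graph_in_specialization[OF this]
  show "a \<in> {a. \<exists>w\<in>specialization R s 2 (line (vec2 1 a)). w $ 0 \<noteq> 0}"
    using index_vec2(1)[of 1 "s a"] by force
next
  fix a assume "a \<in> {a. \<exists>w\<in>specialization R s 2 (line (vec2 1 a)). w $ 0 \<noteq> 0}"
  then show "a \<in> R" using specialization_graph(2)[of _ a] by auto
qed

end

lemma inj_on_data_inflator:
  fixes eK :: "'k0::field \<Rightarrow> 'k::field" and eL :: "'k0 \<Rightarrow> 'l::division_ring"
  shows "inj_on (\<lambda>(R, \<phi>). data_inflator R \<phi>) (valuation_data eK eL)"
proof (rule inj_onI, clarify)
  fix R R' \<phi> \<phi>'
  assume d: "(R, \<phi>) \<in> valuation_data eK eL" and d': "(R', \<phi>') \<in> valuation_data eK eL"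
    and eq: "data_inflator R \<phi> = data_inflator R' \<phi>'"
  interpret p: place R "\<phi> \<circ> residue R" using valuation_data_imp_place[OF d] .
  interpret p': place R' "\<phi>' \<circ> residue R'" using valuation_data_imp_place[OF d'] .
  have spec: "specialization R (\<phi> \<circ> residue R) 2 (line (vec2 1 a))
      = specialization R' (\<phi>' \<circ> residue R') 2 (line (vec2 1 a))" for a
    using fun_cong[OF fun_cong[OF eq], of 2 "line (vec2 1 a)"] line_in_Sub[OF vec2_carrier[of 1 a]]
    by (simp add: data_inflator_eq)
  have R: "R = R'" using p.R_eq p'.R_eq by (simp add: spec)
  have "\<phi> X = \<phi>' X" if "X \<in> carrier (residue_field R)" for X
  proof -
    obtain a where a: "a \<in> R" "X = residue R a" using \<open>X \<in> _\<close> p.carrier_residue_field by auto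
    \<comment> \<open>This vector belongs to both specializations; the equation of the line for the
      second place then forces the two residues of \<open>a\<close> to agree.\<close>
    have "vec2 1 ((\<phi> \<circ> residue R) a) \<in> specialization R' (\<phi>' \<circ> residue R') 2 (line (vec2 1 a))"
      using p.graph_in_specialization[OF a(1)] by (simp add: spec)
    from p'.specialization_graph(1)[OF this] show ?thesis
      using a R by (simp add: index_vec2)
  qed
  then have "\<phi> = \<phi>'" using d d' R by (intro extensionalityI) (auto simp: valuation_data_def)
  with R show "R = R' \<and> \<phi> = \<phi>'" by simp
qed

section \<open>The place of an inflator\<close>

lemma sum_indicator:
  fixes x :: "nat \<Rightarrow> 'a::semiring_1"
  assumes "i < n"
  shows "(\<Sum>k<n. (if k = i then 1 else 0) * x k) = x i"
proof -
  have "(\<Sum>k<n. (if k = i then 1 else 0) * x k) = (\<Sum>k<n. if k = i then x k else 0)"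
    by (intro sum.cong) auto
  then show ?thesis using assms by simp
qed

locale one_inflator = K: K0_algebra eK + L: K0_algebra eL
  for eK :: "'k0::field \<Rightarrow> 'k::field" and eL :: "'k0 \<Rightarrow> 'l::division_ring" +
  fixes f :: "nat \<Rightarrow> 'k vec set \<Rightarrow> 'l vec set"
  assumes inflator: "inflator 1 eK eL (*) f"
begin

section \<open>Basic properties of a one-inflator\<close>

lemma morphism: "directory_morphism (Dir eK (*)) (Dir eL (*)) f"
  using inflator by (simp add: inflator_def)

lemma f_extensional: "f \<in> (\<Pi>\<^sub>E n\<in>{1..}. Sub (*) n \<rightarrow>\<^sub>E Sub (*) n)"
  using morphism by (simp add: directory_morphism_def Sort_Dir)

lemma f_in_Sub: "1 \<le> n \<Longrightarrow> V \<in> Sub (*) n \<Longrightarrow> f n V \<in> Sub (*) n"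
  using PiE_mem[OF f_extensional, of n] by (auto dest: PiE_mem)

lemma f_mono:
  "1 \<le> n \<Longrightarrow> V \<in> Sub (*) n \<Longrightarrow> W \<in> Sub (*) n \<Longrightarrow> V \<subseteq> W \<Longrightarrow> f n V \<subseteq> f n W"
  using morphism unfolding directory_morphism_def Sort_Dir Le_Dir by blast

lemma f_GL:
  assumes n: "1 \<le> n" and A: "A \<in> GL n" and V: "V \<in> Sub (*) n"
  shows "f n ((\<lambda>v. map_mat eK A *\<^sub>v v) ` V) = (\<lambda>u. map_mat eL A *\<^sub>v u) ` f n V"
proof -
  have Ac: "A \<in> carrier_mat n n" using A by (simp add: GL_def)
  have "f n (Act (Dir eK (*)) n A V) = Act (Dir eL (*)) n A (f n V)"
    using morphism n A V by (simp add: directory_morphism_def Sort_Dir)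
  then show ?thesis
    by (simp only: K.Act_Dir[OF Ac V] L.Act_Dir[OF Ac f_in_Sub[OF n V]])
qed

lemma f_oplus:
  "1 \<le> n \<Longrightarrow> 1 \<le> m \<Longrightarrow> V \<in> Sub (*) n \<Longrightarrow> W \<in> Sub (*) m \<Longrightarrow>
    f (n + m) (oplus V W) = oplus (f n V) (f m W)"
  using morphism unfolding directory_morphism_def Sort_Dir Oplus_Dir by blast

lemma module_length_f:
  "1 \<le> n \<Longrightarrow> V \<in> Sub (*) n \<Longrightarrow> module_length (*) n (f n V) = enat (vdim n V)"
  using inflator by (simp add: inflator_def)

lemma f_zero:
  assumes "1 \<le> n" shows "f n {0\<^sub>v n} = {0\<^sub>v n}"
proof -
  have "vdim n {0\<^sub>v n :: 'k vec} = card ({} :: nat set)"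
    by (rule vdim_eq[OF zero_in_Sub, of _ _ "\<lambda>_. 0\<^sub>v n"]) (auto simp: separates_def dual_family_def)
  then have "module_length (*) n (f n {0\<^sub>v n}) = enat 0"
    using module_length_f[OF assms zero_in_Sub] by simp
  then show ?thesis using length_zero_iff[OF f_in_Sub[OF assms zero_in_Sub]] by blast
qed

lemma module_length_f_line:
  assumes n: "1 \<le> n" and v: "v \<in> carrier_vec n" "v \<noteq> 0\<^sub>v n"
  shows "module_length (*) n (f n (line v)) = enat 1"
proof -
  obtain i where i: "i < n" "v $ i \<noteq> 0" using nonzero_coordinate v .
  have "vdim n (line v) = card {i}"
    using vdim_eq[OF line_in_Sub[OF v(1)] _ line_separated[OF v(1) i]] i by simp
  then show ?thesis using module_length_f[OF n line_in_Sub[OF v(1)]] by simp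
qed

lemma ex_nonzero_in_f_line:
  assumes n: "1 \<le> n" and v: "v \<in> carrier_vec n" "v \<noteq> 0\<^sub>v n"
  obtains w where "w \<in> f n (line v)" "w \<in> carrier_vec n" "w \<noteq> 0\<^sub>v n"
proof -
  have S: "f n (line v) \<in> Sub (*) n" using f_in_Sub[OF n line_in_Sub[OF v(1)]] .
  have "f n (line v) \<noteq> {0\<^sub>v n}"
    using module_length_f_line[OF n v] length_zero_iff[OF S] by (auto simp: zero_enat_def)
  then show thesis using that Sub_zero[OF S] Sub_carrier[OF S] by blast
qed

text \<open>
  Equivariance extends from invertible to arbitrary rectangular matrices \<open>B\<close>: the unipotent
  block matrix with lower left block \<open>B\<close> carries \<open>V \<oplus> 0\<close> to the graph of \<open>B\<close> on \<open>V\<close>, and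
  the graph lies in \<open>V \<oplus> B V\<close>.
\<close>

lemma f_mat:
  assumes n: "1 \<le> n" and m: "1 \<le> m" and B: "B \<in> carrier_mat m n" and V: "V \<in> Sub (*) n"
    and w: "w \<in> f n V"
  shows "map_mat eL B *\<^sub>v w \<in> f m ((\<lambda>v. map_mat eK B *\<^sub>v v) ` V)"
proof -
  let ?BV = "(\<lambda>v. map_mat eK B *\<^sub>v v) ` V"
  let ?block = "\<lambda>B. four_block_mat (1\<^sub>m n) (0\<^sub>m n m) B (1\<^sub>m m)"
  have BV: "?BV \<in> Sub (*) m" by (rule K.mat_image_in_Sub[OF B V])
  \<comment> \<open>Shears compose by adding their corner blocks, so \<open>?block (- B)\<close> is
    the inverse of \<open>?block B\<close>.\<close>
  have mult: "?block C * ?block D = 1\<^sub>m (n + m)"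
    if "C \<in> carrier_mat m n" "D \<in> carrier_mat m n" "C + D = 0\<^sub>m m n" for C D :: "'k0 mat"
  proof -
    have "?block C * ?block D = four_block_mat (1\<^sub>m n) (0\<^sub>m n m) (C + D) (1\<^sub>m m)"
      using that by (subst mult_four_block_mat[of _ n n _ m _ m]) auto
    then show ?thesis using that by simp
  qed
  have "?block B * ?block (- B) = 1\<^sub>m (n + m)" "?block (- B) * ?block B = 1\<^sub>m (n + m)"
    using B by (auto intro!: mult)
  then have GL: "?block B \<in> GL (n + m)"
    using B by (auto simp: GL_def invertible_mat_def inverts_mat_def intro!: exI[of _ "?block (- B)"])
  have actK: "map_mat eK (?block B) *\<^sub>v (v @\<^sub>v 0\<^sub>v m) = v @\<^sub>v (map_mat eK B *\<^sub>v v)"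
    if "v \<in> carrier_vec n" for v
    using that B
    by (subst map_four_block_mat[of _ n n _ m _ m])
      (auto simp: K.mat_hom_one four_block_mat_mult_vec[of _ n n _ m _ m])
  have actL: "map_mat eL (?block B) *\<^sub>v (v @\<^sub>v 0\<^sub>v m) = v @\<^sub>v (map_mat eL B *\<^sub>v v)"
    if "v \<in> carrier_vec n" for v
    using that B
    by (subst map_four_block_mat[of _ n n _ m _ m])
      (auto simp: L.mat_hom_one four_block_mat_mult_vec[of _ n n _ m _ m])
  let ?V0 = "oplus V {0\<^sub>v m}"
  have nm: "1 \<le> n + m" using n by simp
  have V0: "?V0 \<in> Sub (*) (n + m)" by (rule oplus_in_Sub[OF V zero_in_Sub])
  have blockc: "?block B \<in> carrier_mat (n + m) (n + m)" using B by simp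
  have "(\<lambda>v. map_mat eK (?block B) *\<^sub>v v) ` ?V0 \<subseteq> oplus V ?BV"
    using actK Sub_carrier[OF V] by auto
  then have "f (n + m) ((\<lambda>v. map_mat eK (?block B) *\<^sub>v v) ` ?V0) \<subseteq> f (n + m) (oplus V ?BV)"
    by (intro f_mono nm K.mat_image_in_Sub[OF blockc] V0 oplus_in_Sub V BV)
  also have "\<dots> = oplus (f n V) (f m ?BV)" by (rule f_oplus[OF n m V BV])
  finally have sub: "(\<lambda>v. map_mat eL (?block B) *\<^sub>v v) ` f (n + m) ?V0 \<subseteq> oplus (f n V) (f m ?BV)"
    by (simp only: f_GL[OF nm GL V0])
  have "w @\<^sub>v 0\<^sub>v m \<in> f (n + m) ?V0"
    using w f_oplus[OF n m V zero_in_Sub] f_zero[OF m] by auto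
  moreover have wc: "w \<in> carrier_vec n" using Sub_carrier[OF f_in_Sub[OF n V] w] .
  ultimately have "w @\<^sub>v (map_mat eL B *\<^sub>v w) \<in> oplus (f n V) (f m ?BV)"
    using sub actL[OF wc] by (metis (no_types, lifting) image_subset_iff)
  then obtain x y where eq: "w @\<^sub>v (map_mat eL B *\<^sub>v w) = x @\<^sub>v y"
    and x: "x \<in> f n V" and y: "y \<in> f m ?BV"
    by blast
  have "map_mat eL B *\<^sub>v w = y"
    using eq append_vec_eq[OF wc Sub_carrier[OF f_in_Sub[OF n V] x]] by blast
  then show ?thesis using y by simp
qed

text \<open>Two linear forms over the base field make up a matrix with two rows. Coordinate
  projections, coordinate swaps and sums of coordinates are all instances.\<close>

lemma f_line_forms:
  assumes n: "1 \<le> n" and v: "v \<in> carrier_vec n" and w: "w \<in> f n (line v)"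
  shows "vec2 (\<Sum>j<n. eL (c j) * w $ j) (\<Sum>j<n. eL (d j) * w $ j)
    \<in> f 2 (line (vec2 (\<Sum>j<n. eK (c j) * v $ j) (\<Sum>j<n. eK (d j) * v $ j)))"
proof -
  define B where "B = mat 2 n (\<lambda>(i, j). if i = 0 then c j else d j)"
  have B: "B \<in> carrier_mat 2 n" by (simp add: B_def)
  have wc: "w \<in> carrier_vec n" using Sub_carrier[OF f_in_Sub[OF n line_in_Sub[OF v]] w] .
  have "map_mat eK B *\<^sub>v (x \<cdot>\<^sub>v v) = x \<cdot>\<^sub>v (map_mat eK B *\<^sub>v v)" for x
    by (rule K.mat_smult_vec[OF B v])
  then have "(\<lambda>v. map_mat eK B *\<^sub>v v) ` line v = line (map_mat eK B *\<^sub>v v)"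
    by (simp add: line_def image_image)
  moreover have "map_mat eK B *\<^sub>v v = vec2 (\<Sum>j<n. eK (c j) * v $ j) (\<Sum>j<n. eK (d j) * v $ j)"
    by (rule vec2_eqI; (subst K.index_mat_vec[OF B v])?) (auto simp: B_def intro: carrier_vecI)
  moreover have "map_mat eL B *\<^sub>v w = vec2 (\<Sum>j<n. eL (c j) * w $ j) (\<Sum>j<n. eL (d j) * w $ j)"
    by (rule vec2_eqI; (subst L.index_mat_vec[OF B wc])?) (auto simp: B_def intro: carrier_vecI)
  ultimately show ?thesis using f_mat[OF n _ B line_in_Sub[OF v] w] by simp
qed

lemma f_line_coords:
  assumes n: "1 \<le> n" and v: "v \<in> carrier_vec n" and w: "w \<in> f n (line v)" and "i < n" "j < n"
  shows "vec2 (w $ i) (w $ j) \<in> f 2 (line (vec2 (v $ i) (v $ j)))"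
proof -
  have e: "eK (if k = i then 1 else 0) = (if k = i then 1 else 0)"
    "eL (if k = i then 1 else 0) = (if k = i then 1 else 0)" for k i :: nat by simp_all
  show ?thesis
    using f_line_forms[OF n v w, of "\<lambda>k. if k = i then 1 else 0" "\<lambda>k. if k = j then 1 else 0"] assms
    by (simp add: e sum_indicator)
qed

section \<open>The place read off from lines in the plane\<close>

definition residue_ring :: "'k set" where
  "residue_ring = {a. \<exists>w\<in>f 2 (line (vec2 1 a)). w $ 0 \<noteq> 0}"

text \<open>Meaningful on \<open>residue_ring\<close> only; for other \<open>a\<close> every vector
  of the image has first coordinate zero and no such \<open>b\<close> exists.\<close>

definition residue_map :: "'k \<Rightarrow> 'l" where
  "residue_map a = (THE b. vec2 1 b \<in> f 2 (line (vec2 1 a)))"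

lemma f_line2_in_Sub: "f 2 (line (vec2 a b)) \<in> Sub (*) 2"
  by (rule f_in_Sub[OF _ line_in_Sub[OF vec2_carrier]]) simp

lemma vec2_nonzero: "vec2 1 (b :: 'a :: zero_neq_one) \<noteq> 0\<^sub>v 2"
  by (metis index_vec2(1) index_zero_vec(1) pos2 zero_neq_one)

text \<open>Left scaling normalises the first coordinate to 1. As the image has length one, the
  normalised vector spans it and is the only one of its shape.\<close>

lemma residue_map_eq:
  assumes w: "w \<in> f 2 (line (vec2 1 a))" "w $ 0 \<noteq> 0"
  shows "a \<in> residue_ring" "residue_map a = inverse (w $ 0) * w $ 1"
    and "f 2 (line (vec2 1 a)) = line (vec2 1 (residue_map a))"
proof -
  show "a \<in> residue_ring" using w by (auto simp: residue_ring_def)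
  have wc: "w \<in> carrier_vec 2" using Sub_carrier[OF f_line2_in_Sub w(1)] .
  define b where "b = inverse (w $ 0) * w $ 1"
  have "inverse (w $ 0) \<cdot>\<^sub>v w = vec2 1 b"
    using wc w by (intro vec2_eqI) (auto simp: b_def)
  then have b: "vec2 1 b \<in> f 2 (line (vec2 1 a))" using Sub_smult[OF f_line2_in_Sub w(1)] by metis
  have line: "f 2 (line (vec2 1 a)) = line (vec2 1 b)"
    using length_one_imp_line[OF f_line2_in_Sub module_length_f_line[OF _ vec2_carrier vec2_nonzero]
        b vec2_nonzero] by simp
  have "residue_map a = b"
    unfolding residue_map_def
  proof (rule the_equality[where P = "\<lambda>b. vec2 1 b \<in> f 2 (line (vec2 1 a))", OF b])
    fix b' assume "vec2 1 b' \<in> f 2 (line (vec2 1 a))"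
    then obtain x where x: "vec2 1 b' = x \<cdot>\<^sub>v vec2 1 b" unfolding line by (auto simp: line_def)
    have "(vec2 1 b') $ 0 = x" "(vec2 1 b') $ 1 = x * b"
      unfolding x by (simp_all add: index_vec2)
    then show "b' = b" by (simp add: index_vec2)
  qed
  then show "residue_map a = inverse (w $ 0) * w $ 1"
    and "f 2 (line (vec2 1 a)) = line (vec2 1 (residue_map a))"
    using line by (simp_all add: b_def)
qed

lemma f_line2_graph:
  assumes a: "a \<in> residue_ring" and w: "vec2 x y \<in> f 2 (line (vec2 1 a))"
  shows "y = x * residue_map a"
proof -
  obtain u where "u \<in> f 2 (line (vec2 1 a))" "u $ 0 \<noteq> 0" using a by (auto simp: residue_ring_def)
  from residue_map_eq(3)[OF this] obtain t where t: "vec2 x y = t \<cdot>\<^sub>v vec2 1 (residue_map a)"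
    using w by (auto simp: line_def)
  have "(vec2 x y) $ 0 = t" "(vec2 x y) $ 1 = t * residue_map a"
    unfolding t by (simp_all add: index_vec2)
  then show ?thesis by (simp add: index_vec2)
qed

lemma residue_map_pairI:
  assumes "vec2 x y \<in> f 2 (line (vec2 1 a))" "x \<noteq> 0"
  shows "a \<in> residue_ring" "residue_map a = inverse x * y"
  using residue_map_eq(1,2)[OF assms(1)] assms(2) by (simp_all add: index_vec2)

abbreviation vec3 :: "'a \<Rightarrow> 'a \<Rightarrow> 'a \<Rightarrow> 'a vec" where
  "vec3 a b c \<equiv> vCons a (vCons b (vCons c vNil))"

lemma index_vec3: "vec3 a b c $ 0 = a" "vec3 a b c $ 1 = b" "vec3 a b c $ 2 = c"
  by (simp_all add: vCons_def numeral_2_eq_2)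

text \<open>One nonzero vector over a line of three-space projects to three planes at once, so the
  same unknown left factor governs all three and residues of different elements become
  comparable.\<close>

lemma ex_f_line3:
  obtains w where "w \<in> f 3 (line (vec3 1 a b))" "w $ 0 \<noteq> 0 \<or> w $ 1 \<noteq> 0 \<or> w $ 2 \<noteq> 0"
    "vec2 (w $ 0) (w $ 1) \<in> f 2 (line (vec2 1 a))"
    "vec2 (w $ 0) (w $ 2) \<in> f 2 (line (vec2 1 b))"
    "vec2 (w $ 1) (w $ 2) \<in> f 2 (line (vec2 a b))"
proof -
  have c: "vec3 1 a b \<in> carrier_vec 3" by (rule carrier_vecI) simp
  have "vec3 1 a b \<noteq> 0\<^sub>v 3"
    by (metis index_vec3(1) index_zero_vec(1) zero_less_numeral zero_neq_one)
  then obtain w where w: "w \<in> f 3 (line (vec3 1 a b))" "w \<in> carrier_vec 3" "w \<noteq> 0\<^sub>v 3"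
    using ex_nonzero_in_f_line[OF _ c] by auto
  obtain i where "i < 3" "w $ i \<noteq> 0" using nonzero_coordinate[OF w(2,3)] .
  moreover from this have "i = 0 \<or> i = 1 \<or> i = 2" by auto
  ultimately have "w $ 0 \<noteq> 0 \<or> w $ 1 \<noteq> 0 \<or> w $ 2 \<noteq> 0" by auto
  then show thesis
    using that[OF w(1)] f_line_coords[OF _ c w(1), of 0 1] f_line_coords[OF _ c w(1), of 0 2]
      f_line_coords[OF _ c w(1), of 1 2] unfolding index_vec3 by simp
qed

text \<open>Here \<open>w\<close> is \<open>w $ 0\<close> times
  \<open>(1, residue_map a, residue_map b)\<close>, so \<open>w $ 0\<close> cannot vanish. The forms
  selecting the first coordinate and summing the other two carry \<open>(1, a, b)\<close> to
  \<open>(1, a + b)\<close>.\<close>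

lemma residue_map_add:
  assumes a: "a \<in> residue_ring" and b: "b \<in> residue_ring"
  shows "a + b \<in> residue_ring" "residue_map (a + b) = residue_map a + residue_map b"
proof -
  obtain w where w: "w \<in> f 3 (line (vec3 1 a b))" "w $ 0 \<noteq> 0 \<or> w $ 1 \<noteq> 0 \<or> w $ 2 \<noteq> 0"
    "vec2 (w $ 0) (w $ 1) \<in> f 2 (line (vec2 1 a))"
    "vec2 (w $ 0) (w $ 2) \<in> f 2 (line (vec2 1 b))"
    by (rule ex_f_line3)
  have w1: "w $ 1 = w $ 0 * residue_map a" by (rule f_line2_graph[OF a w(3)])
  have w2: "w $ 2 = w $ 0 * residue_map b" by (rule f_line2_graph[OF b w(4)])
  have w0: "w $ 0 \<noteq> 0" using w(2) w1 w2 by auto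
  have c: "vec3 1 a b \<in> carrier_vec 3" by (rule carrier_vecI) simp
  have "vec2 (w $ 0) (w $ 1 + w $ 2) \<in> f 2 (line (vec2 1 (a + b)))"
    using f_line_forms[OF _ c w(1), of "\<lambda>k. if k = 0 then 1 else 0" "\<lambda>k. if k = 0 then 0 else 1"]
    by (simp add: eval_nat_numeral lessThan_Suc index_vec3 add.commute)
  from residue_map_pairI[OF this w0, unfolded w1 w2]
  show "a + b \<in> residue_ring" "residue_map (a + b) = residue_map a + residue_map b"
    using w0 by (simp_all add: distrib_left flip: mult.assoc)
qed

lemma residue_map_mult:
  assumes a: "a \<in> residue_ring" and b: "b \<in> residue_ring"
  shows "a * b \<in> residue_ring" "residue_map (a * b) = residue_map a * residue_map b"
proof -
  obtain w where w: "w $ 0 \<noteq> 0 \<or> w $ 1 \<noteq> 0 \<or> w $ 2 \<noteq> 0"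
    "vec2 (w $ 0) (w $ 1) \<in> f 2 (line (vec2 1 a))"
    "vec2 (w $ 0) (w $ 2) \<in> f 2 (line (vec2 1 (a * b)))"
    "vec2 (w $ 1) (w $ 2) \<in> f 2 (line (vec2 a (a * b)))"
    by (rule ex_f_line3)
  have "line (vec2 a (a * b)) \<subseteq> line (vec2 1 b)"
  proof -
    have "vec2 a (a * b) = a \<cdot>\<^sub>v vec2 1 b"
      by (rule vec2_eqI[symmetric]) (auto simp: index_vec2 intro: carrier_vecI)
    then show ?thesis by (auto simp: line_def smult_smult_assoc)
  qed
  \<comment> \<open>An inclusion of lines suffices and covers \<open>a = 0\<close>, where the
    smaller line collapses to zero.\<close>
  then have "f 2 (line (vec2 a (a * b))) \<subseteq> f 2 (line (vec2 1 b))"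
    by (intro f_mono line_in_Sub vec2_carrier) simp_all
  then have w1: "vec2 (w $ 1) (w $ 2) \<in> f 2 (line (vec2 1 b))" using w(4) by blast
  have w1: "w $ 1 = w $ 0 * residue_map a" and w2: "w $ 2 = w $ 1 * residue_map b"
    using f_line2_graph a b w(2) w1 by blast+
  have w0: "w $ 0 \<noteq> 0" using w(1) w1 w2 by auto
  from residue_map_pairI[OF w(3) w0, unfolded w2 w1]
  show "a * b \<in> residue_ring" "residue_map (a * b) = residue_map a * residue_map b"
    using w0 by (simp_all flip: mult.assoc)
qed

text \<open>The line \<open>K\<close> itself is pushed into the plane by the forms \<open>1\<close>
  and \<open>c\<close>. The conjugate \<open>inverse (w $ 0) * eL c * w $ 0\<close> reduces to
  \<open>eL c\<close> by centrality.\<close>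

lemma residue_map_base: "eK c \<in> residue_ring" "residue_map (eK c) = eL c"
proof -
  define v :: "'k vec" where "v = vec 1 (\<lambda>_. 1)"
  have v: "v \<in> carrier_vec 1" "v \<noteq> 0\<^sub>v 1" by (auto simp: v_def vec_eq_iff)
  obtain w where w: "w \<in> f 1 (line v)" "w \<in> carrier_vec 1" "w \<noteq> 0\<^sub>v 1"
    using ex_nonzero_in_f_line[OF _ v] by auto
  have w0: "w $ 0 \<noteq> 0" using nonzero_coordinate[OF w(2,3)] by auto
  have "vec2 (w $ 0) (eL c * w $ 0) \<in> f 2 (line (vec2 1 (eK c)))"
    using f_line_forms[OF _ v(1) w(1), of "\<lambda>_. 1" "\<lambda>_. c"] by (simp add: v_def)
  from residue_map_pairI[OF this w0]
  show "eK c \<in> residue_ring" "residue_map (eK c) = eL c"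
    using w0 by (simp_all add: L.central mult.assoc[symmetric])
qed

text \<open>If the image of the line of \<open>(1, a)\<close> has only zeros in its first
  coordinate, swapping coordinates gives a vector with second coordinate zero over the line of
  \<open>(a, 1)\<close>, which is that of \<open>(1, inverse a)\<close>.\<close>

lemma inverse_in_residue_ring:
  assumes a: "a \<notin> residue_ring"
  shows "inverse a \<in> residue_ring" "residue_map (inverse a) = 0"
proof -
  have a0: "a \<noteq> 0" using a residue_map_base(1)[of 0] by auto
  obtain w where w: "w \<in> f 2 (line (vec2 1 a))" "w \<in> carrier_vec 2" "w \<noteq> 0\<^sub>v 2"
    using ex_nonzero_in_f_line[OF _ vec2_carrier vec2_nonzero, of a] by auto
  have w0: "w $ 0 = 0" using a w by (auto simp: residue_ring_def)
  have w1: "w $ 1 \<noteq> 0"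
    using nonzero_coordinate[OF w(2,3)] w0 by (metis less_2_cases One_nat_def)
  have "line (vec2 a 1) \<subseteq> line (vec2 1 (inverse a))"
  proof -
    have "vec2 a 1 = a \<cdot>\<^sub>v vec2 1 (inverse a)"
      using a0 by (intro vec2_eqI[symmetric]) (auto simp: index_vec2 intro: carrier_vecI)
    then show ?thesis by (auto simp: line_def smult_smult_assoc)
  qed
  then have "f 2 (line (vec2 a 1)) \<subseteq> f 2 (line (vec2 1 (inverse a)))"
    by (intro f_mono line_in_Sub vec2_carrier) simp_all
  then have "vec2 (w $ 1) (w $ 0) \<in> f 2 (line (vec2 1 (inverse a)))"
    using f_line_coords[OF _ vec2_carrier w(1), of 1 0] unfolding index_vec2 by auto
  from residue_map_pairI[OF this w1]
  show "inverse a \<in> residue_ring" "residue_map (inverse a) = 0" by (simp_all add: w0)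
qed

lemma place: "place residue_ring residue_map"
proof
  have one: "1 \<in> residue_ring" "residue_map 1 = 1" using residue_map_base[of 1] by simp_all
  have uminus: "- a \<in> residue_ring" if "a \<in> residue_ring" for a
    using residue_map_mult(1)[OF residue_map_base(1)[of "- 1"] that] by (simp add: K.hom_uminus)
  have "subring residue_ring class_ring"
    using one uminus residue_map_add residue_map_mult
    by (intro ring.subringI class_ring.ring_axioms) (auto simp: class_ring_simps)
  then show "valuation_ring residue_ring"
    using inverse_in_residue_ring by (auto simp: valuation_ring_def)
  show "residue_map 1 = 1" by (rule one)
  show "residue_map (x + y) = residue_map x + residue_map y"
    "residue_map (x * y) = residue_map x * residue_map y"
    if "x \<in> residue_ring" "y \<in> residue_ring" for x y
    using that residue_map_add residue_map_mult by auto
  show "residue_map x = 0 \<longleftrightarrow> x \<in> max_ideal residue_ring" if x: "x \<in> residue_ring" for x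
  proof
    assume "residue_map x = 0"
    then have "inverse x \<notin> residue_ring" if "x \<noteq> 0"
      using residue_map_mult(2)[OF x, of "inverse x"] that one by auto
    then show "x \<in> max_ideal residue_ring" using x by (auto simp: max_ideal_def)
  next
    assume "x \<in> max_ideal residue_ring"
    \<comment> \<open>A nonzero \<open>x\<close> is the inverse of an element outside the ring;
      \<open>x = 0\<close> is the image of the base scalar 0.\<close>
    then show "residue_map x = 0"
      using residue_map_base(2)[of 0] inverse_in_residue_ring(2)[of "inverse x"]
      by (auto simp: max_ideal_def)
  qed
qed

section \<open>Comparison with the specialization along the place\<close>

sublocale place residue_ring residue_map
  by (rule place)

text \<open>If some coordinate of \<open>v\<close> has nonzero residue, it is a unit, and dividing
  by it gives an integral \<open>u\<close> on the same line with a coordinate 1. Comparing each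
  coordinate of a nonzero \<open>w\<close> in \<open>f n (line u)\<close> with coordinate
  \<open>i\<close> shows that \<open>w\<close> is a left multiple of
  \<open>map_vec residue_map u\<close>.\<close>

lemma map_vec_in_f:
  assumes n: "1 \<le> n" and V: "V \<in> Sub (*) n" and v: "v \<in> integral_vecs residue_ring V"
  shows "map_vec residue_map v \<in> f n V"
proof -
  have vV: "v \<in> V" using v by (simp add: integral_vecs_def)
  have vc: "v \<in> carrier_vec n" using Sub_carrier[OF V vV] .
  have vR: "v $ i \<in> residue_ring" if "i < n" for i using integral_vecs_R[OF v] that vc by simp
  show ?thesis
  proof (cases "\<forall>i<n. residue_map (v $ i) = 0")
    case True
    then have "map_vec residue_map v = 0\<^sub>v n" using vc by (intro eq_vecI) auto
    then show ?thesis using Sub_zero[OF f_in_Sub[OF n V]] by simp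
  next
    case False
    then obtain i where i: "i < n" "residue_map (v $ i) \<noteq> 0" by auto
    define u where "u = inverse (v $ i) \<cdot>\<^sub>v v"
    have inv: "inverse (v $ i) \<in> residue_ring" and vi: "v $ i \<noteq> 0"
      using i vR s_eq_0_iff by (auto simp: max_ideal_def)
    have uc: "u \<in> carrier_vec n" using vc by (simp add: u_def)
    have ui: "u $ i = 1" using vi i vc by (simp add: u_def)
    have uR: "u $ j \<in> residue_ring" if "j < n" for j
      using mult_R[OF inv vR[OF that]] that vc by (simp add: u_def)
    have vu: "v $ j = v $ i * u $ j" if "j < n" for j using that vc vi by (simp add: u_def)
    have "u \<noteq> 0\<^sub>v n" using ui i by auto
    then obtain w where w: "w \<in> f n (line u)" "w \<in> carrier_vec n" "w \<noteq> 0\<^sub>v n"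
      using ex_nonzero_in_f_line[OF n uc] by blast
    have wj: "w $ j = w $ i * residue_map (u $ j)" if "j < n" for j
      using f_line_coords[OF n uc w(1) i(1) that] f_line2_graph[OF uR[OF that]] ui by simp
    have wi: "w $ i \<noteq> 0"
    proof
      assume "w $ i = 0"
      then have "w = 0\<^sub>v n" using w wj by (intro eq_vecI) auto
      then show False using w by simp
    qed
    \<comment> \<open>The coefficient first removes the left factor \<open>w $ i\<close> of
      \<open>w\<close>, then restores the residue of the unit by which \<open>v\<close> was
      divided.\<close>
    have "map_vec residue_map v = (residue_map (v $ i) * inverse (w $ i)) \<cdot>\<^sub>v w"
    proof (rule eq_vecI)
      fix j assume "j < dim_vec ((residue_map (v $ i) * inverse (w $ i)) \<cdot>\<^sub>v w)"
      then have j: "j < n" using w by simp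
      have "residue_map (v $ j) = residue_map (v $ i) * residue_map (u $ j)"
        unfolding vu[OF j] by (rule s_mult[OF vR[OF i(1)] uR[OF j]])
      also have "\<dots> = residue_map (v $ i) * inverse (w $ i) * (w $ i * residue_map (u $ j))"
        using wi by (simp add: mult.assoc[symmetric]) (simp add: mult.assoc)
      also have "w $ i * residue_map (u $ j) = w $ j" using wj[OF j] by simp
      finally show "map_vec residue_map v $ j = ((residue_map (v $ i) * inverse (w $ i)) \<cdot>\<^sub>v w) $ j"
        using j vc w by simp
    qed (use vc w in simp)
    then have "map_vec residue_map v \<in> f n (line u)"
      using Sub_smult[OF f_in_Sub[OF n line_in_Sub[OF uc]] w(1)] by simp
    moreover have "f n (line u) \<subseteq> f n V"
      by (intro f_mono n V line_in_Sub uc)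
        (auto simp: line_def u_def smult_smult_assoc intro!: Sub_smult[OF V] vV)
    ultimately show ?thesis by blast
  qed
qed

lemma f_eq_specialization:
  assumes n: "1 \<le> n" and V: "V \<in> Sub (*) n"
  shows "f n V = specialization residue_ring residue_map n V"
proof -
  have "specialization residue_ring residue_map n V \<subseteq> f n V"
    by (rule specialization_subset[OF map_vec_in_f[OF n V] f_in_Sub[OF n V]])
  then show ?thesis
    using Sub_eq_by_length[OF specialization_in_Sub[OF V] f_in_Sub[OF n V] _
        module_length_specialization[OF V] module_length_f[OF n V]] by simp
qed

lemma f_in_image: "f \<in> (\<lambda>(R, \<phi>). data_inflator R \<phi>) ` valuation_data eK eL"
proof -
  obtain \<phi> where \<phi>: "(residue_ring, \<phi>) \<in> valuation_data eK eL"
    "\<And>x. x \<in> residue_ring \<Longrightarrow> \<phi> (residue residue_ring x) = residue_map x"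
    using ex_valuation_data[of eK eL] residue_map_base by blast
  have "f = (\<lambda>n\<in>{1..}. \<lambda>V\<in>Sub (*) n. specialization residue_ring residue_map n V)"
  proof (rule PiE_ext[OF f_extensional])
    show "(\<lambda>n\<in>{1..}. \<lambda>V\<in>Sub (*) n. specialization residue_ring residue_map n V)
        \<in> (\<Pi>\<^sub>E n\<in>{1..}. Sub (*) n \<rightarrow>\<^sub>E Sub (*) n)"
      using specialization_in_Sub by auto
    fix n :: nat assume n: "n \<in> {1..}"
    have "f n = (\<lambda>V\<in>Sub (*) n. specialization residue_ring residue_map n V)"
      using f_eq_specialization n PiE_mem[OF f_extensional n]
      by (intro extensionalityI[of _ "Sub (*) n"]) (auto simp: PiE_def)
    then show "f n = (\<lambda>n\<in>{1..}. \<lambda>V\<in>Sub (*) n. specialization residue_ring residue_map n V) n"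
      using n by simp
  qed
  also have "\<dots> = data_inflator residue_ring \<phi>"
    unfolding data_inflator_eq
    using specialization_cong[of residue_ring residue_map "\<phi> \<circ> residue residue_ring"] \<phi>(2) by simp
  finally show ?thesis using \<phi>(1) by force
qed

end

theorem corollary5p21:
  fixes eK :: "'k0::field \<Rightarrow> 'k::field"
    and eL :: "'k0 \<Rightarrow> 'l::division_ring"
  assumes "infinite (UNIV :: 'k0 set)"
    and "K0_algebra eK"
    and "K0_algebra eL"
  shows "bij_betw (\<lambda>(R, \<phi>). data_inflator R \<phi>)
           (valuation_data eK eL)
           {f. inflator 1 eK eL (*) f}"
  unfolding bij_betw_def
proof (intro conjI inj_on_data_inflator subset_antisym subsetI)
  fix f assume "f \<in> (\<lambda>(R, \<phi>). data_inflator R \<phi>) ` valuation_data eK eL"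
  then obtain R \<phi> where d: "(R, \<phi>) \<in> valuation_data eK eL" and f: "f = data_inflator R \<phi>"
    by auto
  have "range eK \<subseteq> R" "(\<phi> \<circ> residue R) (eK c) = eL c" for c
    using d by (auto simp: valuation_data_def)
  then show "f \<in> {f. inflator 1 eK eL (*) f}"
    unfolding f data_inflator_eq
    using place.inflator_specialization[OF valuation_data_imp_place[OF d] assms(2,3)] by simp
next
  fix f assume "f \<in> {f. inflator 1 eK eL (*) f}"
  then interpret one_inflator eK eL f
    using assms by (simp add: one_inflator_def one_inflator_axioms_def)
  show "f \<in> (\<lambda>(R, \<phi>). data_inflator R \<phi>) ` valuation_data eK eL" by (rule f_in_image)
qed

end
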